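(* Let $H$ be a rank-one torsion-free abelian group, regarded as a subgroup of $\mathbb{Q}$ via a fixed embedding, and let $K$ be a non-trivial finite-rank torsion-free abelian group. Let $G$ be the ordered abelian group $H\oplus K$ with positive cone $G^+=\{(h,k)\in H\oplus K \mid h>0\}\cup\{0\}$. If $\operatorname{outer\,type} K\wedge \operatorname{type} H= \operatorname{type}\mathbb{Z}$, then $G$ is not ultrasimplicial.
   Context: Rank means torsion-free rank, and independent means linearly independent over $\mathbb{Z}$. Ultrasimplicial: a simplicial group is a group $\mathbb{Z}^m$ (some finite $m$) with the coordinatewise order, i.e. positive cone $\mathbb{Z}_{\ge 0}^m$. A countable ordered abelian group is a dimension group if it is isomorphic, in the category of ordered abelian groups (with positive homomorphisms as morphisms), to the inductive limit of a sequence of simplicial groups. A dimension group is ultrasimplicial if it is isomorphic to such an inductive limit in which all the maps are injective. Types: let $A$ be a torsion-free abelian group and $a\in A$. For a prime $p$, the $p$-height $h_p^A(a)$ is $m$ if $a\in p^mA\setminus p^{m+1}A$ for some $m\ge 0$, and $\infty$ if there is no such $m$. The height of $a$ in $A$ is the sequence $(h_p^A(a))_{p}$ indexed by all primes. Sequences $(\alpha_p)_p$ with values in $\{0,1,2,\dots\}\cup\{\infty\}$ are ordered by $\alpha\le\beta$ iff $\alpha_p\le\beta_p$ for all $p$; this is a lattice order with pointwise minimum $\wedge$ and pointwise maximum $\vee$. Two such sequences are equivalent if they differ at only finitely many primes and, whenever $\alpha_p=\infty$ or $\beta_p=\infty$, one has $\alpha_p=\beta_p$. Equivalence classes are called types;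 the order and the operations $\wedge,\vee$ descend to types, which form a lattice. $\operatorname{type}_A(a)$ is the class of the height of $a$ in $A$. If $A$ has rank one, all non-zero elements have the same type, denoted $\operatorname{type}(A)$; in particular $\operatorname{type}\mathbb{Z}$ is the class of the zero sequence. Outer type: for a subset $S$ of a torsion-free abelian group $A$, the pure subgroup generated by $S$ is $\langle S\rangle_*=\{a\in A\mid na\in\langle S\rangle\text{ for some non-zero } n\in\mathbb{Z}\}$. If $A$ is a finite-rank torsion-free abelian group and $x_1,\dots,x_n$ is a maximal independent subset of $A$, put $Y_i=\langle x_1,\dots,x_{i-1},x_{i+1},\dots,x_n\rangle_*$; then $A/Y_i$ is torsion-free of rank one, and $\operatorname{outer\,type}(A)=\bigvee_{i=1}^n\operatorname{type}(A/Y_i)$. This does not depend on the choice of maximal independent subset. *)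

theory Defs
  imports
    Complex_Main
    "HOL-Library.Extended_Nat"
    "HOL-Computational_Algebra.Primes"
    "HOL-Algebra.Coset"
    "HOL-Algebra.FiniteProduct"
    "HOL-Algebra.Generated_Groups"
    "HOL-Algebra.Elementary_Groups"
    "HOL-Algebra.Product_Groups"
begin

text \<open>
  Abelian groups are HOL-Algebra commutative groups, hence written multiplicatively: \<open>n a\<close>
  is \<open>a [^] n\<close> and \<open>0\<close> is \<open>\<one>\<close>.
\<close>

section \<open>Torsion-free groups and rank\<close>

definition torsion_free :: "('a, 'b) monoid_scheme \<Rightarrow> bool" where
  "torsion_free A \<longleftrightarrow>
     (\<forall>a\<in>carrier A. \<forall>n::int. n \<noteq> 0 \<longrightarrow> a [^]\<^bsub>A\<^esub> n = \<one>\<^bsub>A\<^esub> \<longrightarrow> a = \<one>\<^bsub>A\<^esub>)"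

definition independent_in :: "('a, 'b) monoid_scheme \<Rightarrow> 'a set \<Rightarrow> bool" where
  "independent_in A X \<longleftrightarrow> X \<subseteq> carrier A \<and>
     (\<forall>F (c :: 'a \<Rightarrow> int). finite F \<and> F \<subseteq> X \<and>
        finprod A (\<lambda>x. x [^]\<^bsub>A\<^esub> c x) F = \<one>\<^bsub>A\<^esub> \<longrightarrow> (\<forall>x\<in>F. c x = 0))"

definition max_independent_in :: "('a, 'b) monoid_scheme \<Rightarrow> 'a set \<Rightarrow> bool" where
  "max_independent_in A X \<longleftrightarrow>
     independent_in A X \<and> (\<forall>Y. independent_in A Y \<and> X \<subseteq> Y \<longrightarrow> Y = X)"

definition has_rank :: "('a, 'b) monoid_scheme \<Rightarrow> nat \<Rightarrow> bool" where
  "has_rank A n \<longleftrightarrow> (\<exists>X. max_independent_in A X \<and> finite X \<and> card X = n)"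

definition finite_rank :: "('a, 'b) monoid_scheme \<Rightarrow> bool" where
  "finite_rank A \<longleftrightarrow> (\<exists>n. has_rank A n)"

definition pure_subgroup :: "('a, 'b) monoid_scheme \<Rightarrow> 'a set \<Rightarrow> 'a set" where
  "pure_subgroup A S = {a \<in> carrier A. \<exists>n::int. n \<noteq> 0 \<and> a [^]\<^bsub>A\<^esub> n \<in> generate A S}"


section \<open>Types\<close>

text \<open>
  Sequences indexed by the primes are represented by functions on all of \<open>nat\<close>; the
  equivalence relation ignores the values at non-primes.
\<close>

definition type_equiv :: "(nat \<Rightarrow> enat) \<Rightarrow> (nat \<Rightarrow> enat) \<Rightarrow> bool" where
  "type_equiv \<alpha> \<beta> \<longleftrightarrow> finite {p. prime p \<and> \<alpha> p \<noteq> \<beta> p} \<and>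
     (\<forall>p. prime p \<longrightarrow> \<alpha> p = \<infinity> \<or> \<beta> p = \<infinity> \<longrightarrow> \<alpha> p = \<beta> p)"

lemma type_equivI:
  assumes "\<And>p. prime p \<Longrightarrow> \<alpha> p = \<beta> p"
  shows "type_equiv \<alpha> \<beta>"
proof -
  have "{p. prime p \<and> \<alpha> p \<noteq> \<beta> p} = {}" using assms by blast
  then have "finite {p. prime p \<and> \<alpha> p \<noteq> \<beta> p}" by (simp only: finite.emptyI)
  then show ?thesis using assms unfolding type_equiv_def by blast
qed

lemma equivp_type_equiv: "equivp type_equiv"
proof (rule equivpI)
  show "reflp type_equiv" by (simp add: reflp_def type_equiv_def)
  show "symp type_equiv"
  proof (rule sympI)
    fix \<alpha> \<beta> assume *: "type_equiv \<alpha> \<beta>"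
    have "{p. prime p \<and> \<beta> p \<noteq> \<alpha> p} = {p. prime p \<and> \<alpha> p \<noteq> \<beta> p}"
      by (intro Collect_cong conj_cong refl) (rule neq_commute)
    with * have "finite {p. prime p \<and> \<beta> p \<noteq> \<alpha> p}" by (simp only: type_equiv_def)
    moreover have "\<beta> p = \<alpha> p" if "prime p" "\<beta> p = \<infinity> \<or> \<alpha> p = \<infinity>" for p
    proof -
      from * that have "\<alpha> p = \<beta> p" unfolding type_equiv_def by blast
      then show ?thesis by (rule sym)
    qed
    ultimately show "type_equiv \<beta> \<alpha>" unfolding type_equiv_def by blast
  qed
  show "transp type_equiv"
  proof (rule transpI)
    fix \<alpha> \<beta> \<gamma> assume *: "type_equiv \<alpha> \<beta>" "type_equiv \<beta> \<gamma>"
    have "finite ({p. prime p \<and> \<alpha> p \<noteq> \<beta> p} \<union> {p. prime p \<and> \<beta> p \<noteq> \<gamma> p})"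
      using * by (simp add: type_equiv_def)
    then have "finite {p. prime p \<and> \<alpha> p \<noteq> \<gamma> p}"
      by (rule rev_finite_subset) auto
    moreover have "\<alpha> p = \<gamma> p" if "prime p" "\<alpha> p = \<infinity> \<or> \<gamma> p = \<infinity>" for p
    proof -
      have "\<alpha> p = \<infinity> \<or> \<beta> p = \<infinity> \<Longrightarrow> \<alpha> p = \<beta> p" "\<beta> p = \<infinity> \<or> \<gamma> p = \<infinity> \<Longrightarrow> \<beta> p = \<gamma> p"
        using * \<open>prime p\<close> unfolding type_equiv_def by blast+
      with that(2) show ?thesis by argo
    qed
    ultimately show "type_equiv \<alpha> \<gamma>" unfolding type_equiv_def by blast
  qed
qed

quotient_type htype = "nat \<Rightarrow> enat" / type_equiv
  by (rule equivp_type_equiv)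

lemma type_equiv_pointwise:
  fixes f :: "enat \<Rightarrow> enat \<Rightarrow> enat"
  assumes "type_equiv \<alpha> \<alpha>'" "type_equiv \<beta> \<beta>'"
    and inf: "\<And>a b a' b'. \<lbrakk>a = \<infinity> \<or> a' = \<infinity> \<Longrightarrow> a = a'; b = \<infinity> \<or> b' = \<infinity> \<Longrightarrow> b = b';
                 f a b = \<infinity> \<or> f a' b' = \<infinity>\<rbrakk> \<Longrightarrow> f a b = f a' b'"
  shows "type_equiv (\<lambda>p. f (\<alpha> p) (\<beta> p)) (\<lambda>p. f (\<alpha>' p) (\<beta>' p))"
proof -
  have "finite ({p. prime p \<and> \<alpha> p \<noteq> \<alpha>' p} \<union> {p. prime p \<and> \<beta> p \<noteq> \<beta>' p})"
    using assms by (simp add: type_equiv_def)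
  then have "finite {p. prime p \<and> f (\<alpha> p) (\<beta> p) \<noteq> f (\<alpha>' p) (\<beta>' p)}"
    by (rule rev_finite_subset) auto
  moreover have "f (\<alpha> p) (\<beta> p) = f (\<alpha>' p) (\<beta>' p)"
    if "prime p" "f (\<alpha> p) (\<beta> p) = \<infinity> \<or> f (\<alpha>' p) (\<beta>' p) = \<infinity>" for p
    using assms(1,2) that(1) that(2) unfolding type_equiv_def by (intro inf) blast+
  ultimately show ?thesis unfolding type_equiv_def by blast
qed

instantiation htype :: lattice
begin

lift_definition inf_htype :: "htype \<Rightarrow> htype \<Rightarrow> htype" is "\<lambda>\<alpha> \<beta> p. min (\<alpha> p) (\<beta> p)"
  by (erule (1) type_equiv_pointwise) (auto simp: min_def split: if_splits)

lift_definition sup_htype :: "htype \<Rightarrow> htype \<Rightarrow> htype" is "\<lambda>\<alpha> \<beta> p. max (\<alpha> p) (\<beta> p)"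
  by (erule (1) type_equiv_pointwise) (auto simp: max_def split: if_splits)

definition less_eq_htype :: "htype \<Rightarrow> htype \<Rightarrow> bool" where
  "s \<le> t \<longleftrightarrow> (\<exists>\<alpha> \<beta>. s = abs_htype \<alpha> \<and> t = abs_htype \<beta> \<and> (\<forall>p. prime p \<longrightarrow> \<alpha> p \<le> \<beta> p))"

definition less_htype :: "htype \<Rightarrow> htype \<Rightarrow> bool" where
  "(s::htype) < t \<longleftrightarrow> s \<le> t \<and> \<not> t \<le> s"

instance
proof -
  have le_iff: "s \<le> t \<longleftrightarrow> inf s t = s" for s t :: htype
  proof
    assume "s \<le> t"
    then obtain \<alpha> \<beta> where "s = abs_htype \<alpha>" "t = abs_htype \<beta>" "\<forall>p. prime p \<longrightarrow> \<alpha> p \<le> \<beta> p"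
      unfolding less_eq_htype_def by blast
    moreover from this(3) have "prime p \<longrightarrow> min (\<alpha> p) (\<beta> p) = \<alpha> p" for p
      by (simp add: min_absorb1)
    then have "type_equiv (\<lambda>p. min (\<alpha> p) (\<beta> p)) \<alpha>"
      by (intro type_equivI) blast
    ultimately show "inf s t = s"
      by (simp add: inf_htype.abs_eq htype.abs_eq_iff)
  next
    assume "inf s t = s"
    moreover obtain \<alpha> \<beta> where "s = abs_htype \<alpha>" "t = abs_htype \<beta>"
      by (metis Quotient_abs_rep[OF Quotient_htype])
    ultimately have "s = abs_htype (\<lambda>p. min (\<alpha> p) (\<beta> p))" "t = abs_htype \<beta>"
      by (auto simp: inf_htype.abs_eq)
    then show "s \<le> t" unfolding less_eq_htype_def
      by (metis min.cobounded2)
  qed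
  have inf_assoc: "inf (inf s t) u = inf s (inf t u)" for s t u :: htype
    by transfer (simp add: type_equiv_def min.assoc)
  have inf_comm: "inf s t = inf t s" for s t :: htype
    by transfer (simp add: type_equiv_def min.commute)
  have inf_idem: "inf s s = s" for s :: htype
    by transfer (simp add: type_equiv_def)
  have sup_assoc: "sup (sup s t) u = sup s (sup t u)" for s t u :: htype
    by transfer (simp add: type_equiv_def max.assoc)
  have sup_comm: "sup s t = sup t s" for s t :: htype
    by transfer (simp add: type_equiv_def max.commute)
  have absorb1: "inf s (sup s t) = s" for s t :: htype
    by transfer (simp add: type_equiv_def)
  have absorb2: "sup s (inf s t) = s" for s t :: htype
    by transfer (simp add: type_equiv_def)
  have le_iff': "s \<le> t \<longleftrightarrow> sup s t = t" for s t :: htype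
    by (metis le_iff absorb1 absorb2 inf_comm sup_comm)
  show "OFCLASS(htype, lattice_class)"
  proof
    fix s t u :: htype
    show "s < t \<longleftrightarrow> s \<le> t \<and> \<not> t \<le> s" by (rule less_htype_def)
    show "s \<le> s" by (simp add: le_iff inf_idem)
    show "s \<le> t \<Longrightarrow> t \<le> u \<Longrightarrow> s \<le> u" by (metis le_iff inf_assoc)
    show "s \<le> t \<Longrightarrow> t \<le> s \<Longrightarrow> s = t" by (metis le_iff inf_comm)
    show "inf s t \<le> s" by (metis le_iff inf_assoc inf_comm inf_idem)
    show "inf s t \<le> t" by (metis le_iff inf_assoc inf_idem)
    show "s \<le> t \<Longrightarrow> s \<le> u \<Longrightarrow> s \<le> inf t u"
      by (simp add: le_iff inf_assoc[symmetric])
    show "s \<le> sup s t" by (simp add: le_iff absorb1)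
    show "t \<le> sup s t" by (metis le_iff absorb1 sup_comm)
    show "t \<le> s \<Longrightarrow> u \<le> s \<Longrightarrow> sup t u \<le> s" by (simp add: le_iff' sup_assoc)
  qed
qed

end

definition multiples :: "('a, 'b) monoid_scheme \<Rightarrow> nat \<Rightarrow> 'a set" where
  "multiples A n = (\<lambda>a. a [^]\<^bsub>A\<^esub> n) ` carrier A"

definition p_height :: "('a, 'b) monoid_scheme \<Rightarrow> 'a \<Rightarrow> nat \<Rightarrow> enat" where
  "p_height A a p =
     (if \<exists>m. a \<in> multiples A (p ^ m) - multiples A (p ^ Suc m)
      then enat (THE m. a \<in> multiples A (p ^ m) - multiples A (p ^ Suc m))
      else \<infinity>)"

definition type_of :: "('a, 'b) monoid_scheme \<Rightarrow> 'a \<Rightarrow> htype" where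
  "type_of A a = abs_htype (p_height A a)"

text \<open>
  The next two definitions fix an arbitrary non-zero element, respectively an arbitrary finite
  maximal independent subset; the result does not depend on the choice when \<open>A\<close> is torsion-free
  of rank one, respectively torsion-free of non-zero finite rank.
\<close>

definition group_type :: "('a, 'b) monoid_scheme \<Rightarrow> htype" where
  "group_type A = type_of A (SOME a. a \<in> carrier A \<and> a \<noteq> \<one>\<^bsub>A\<^esub>)"

definition outer_type_wrt :: "('a, 'b) monoid_scheme \<Rightarrow> 'a set \<Rightarrow> htype" where
  "outer_type_wrt A X =
     Sup_fin ((\<lambda>x. group_type (A Mod pure_subgroup A (X - {x}))) ` X)"

definition outer_type :: "('a, 'b) monoid_scheme \<Rightarrow> htype" where
  "outer_type A = outer_type_wrt A (SOME X. finite X \<and> max_independent_in A X)"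


section \<open>Ordered abelian groups\<close>

text \<open>An ordered abelian group is given by a group together with its positive cone.\<close>

locale ordered_abelian_group = comm_group G for G (structure) +
  fixes P :: "'a set"
  assumes cone_subset: "P \<subseteq> carrier G"
    and one_in_cone: "\<one> \<in> P"
    and cone_mult: "\<lbrakk>x \<in> P; y \<in> P\<rbrakk> \<Longrightarrow> x \<otimes> y \<in> P"
    and cone_antisym: "\<lbrakk>x \<in> P; inv x \<in> P\<rbrakk> \<Longrightarrow> x = \<one>"

definition positive_hom ::
  "('a, 'c) monoid_scheme \<Rightarrow> 'a set \<Rightarrow> ('b, 'd) monoid_scheme \<Rightarrow> 'b set \<Rightarrow> ('a \<Rightarrow> 'b) set" where
  "positive_hom G P G' P' = {f \<in> hom G G'. f ` P \<subseteq> P'}"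

definition order_isomorphic ::
  "('a, 'c) monoid_scheme \<Rightarrow> 'a set \<Rightarrow> ('b, 'd) monoid_scheme \<Rightarrow> 'b set \<Rightarrow> bool" where
  "order_isomorphic G P G' P' \<longleftrightarrow>
     (\<exists>f \<in> positive_hom G P G' P'. \<exists>g \<in> positive_hom G' P' G P.
        (\<forall>x\<in>carrier G. g (f x) = x) \<and> (\<forall>y\<in>carrier G'. f (g y) = y))"

definition simplicial_group :: "nat \<Rightarrow> (nat \<Rightarrow> int) monoid" where
  "simplicial_group m = product_group {..<m} (\<lambda>_. integer_group)"

definition simplicial_cone :: "nat \<Rightarrow> (nat \<Rightarrow> int) set" where
  "simplicial_cone m = {x \<in> carrier (simplicial_group m). \<forall>i<m. 0 \<le> x i}"

text \<open>
  The inductive limit of \<open>A 0 \<rightarrow> A 1 \<rightarrow> A 2 \<rightarrow> \<dots>\<close> with maps \<open>\<phi> n\<close> from \<open>A n\<close> to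
  \<open>A (Suc n)\<close>: the disjoint union of the groups \<open>A n\<close> modulo eventual equality.
  Its positive cone consists of the images of the positive cones \<open>P n\<close>.
  For \<open>i \<le> j\<close>, \<open>transition \<phi> i j\<close> is the composite map from \<open>A i\<close> to \<open>A j\<close>.
\<close>

definition transition :: "(nat \<Rightarrow> 'a \<Rightarrow> 'a) \<Rightarrow> nat \<Rightarrow> nat \<Rightarrow> 'a \<Rightarrow> 'a" where
  "transition \<phi> i j = fold \<phi> [i..<j]"

definition limit_rel ::
  "(nat \<Rightarrow> ('a, 'b) monoid_scheme) \<Rightarrow> (nat \<Rightarrow> 'a \<Rightarrow> 'a) \<Rightarrow> ((nat \<times> 'a) \<times> (nat \<times> 'a)) set" where
  "limit_rel A \<phi> = {((i, x), (j, y)) | i x j y. x \<in> carrier (A i) \<and> y \<in> carrier (A j) \<and>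
     (\<exists>k. i \<le> k \<and> j \<le> k \<and> transition \<phi> i k x = transition \<phi> j k y)}"

definition limit_class ::
  "(nat \<Rightarrow> ('a, 'b) monoid_scheme) \<Rightarrow> (nat \<Rightarrow> 'a \<Rightarrow> 'a) \<Rightarrow> nat \<Rightarrow> 'a \<Rightarrow> (nat \<times> 'a) set" where
  "limit_class A \<phi> i x = limit_rel A \<phi> `` {(i, x)}"

definition inductive_limit ::
  "(nat \<Rightarrow> ('a, 'b) monoid_scheme) \<Rightarrow> (nat \<Rightarrow> 'a \<Rightarrow> 'a) \<Rightarrow> (nat \<times> 'a) set monoid" where
  "inductive_limit A \<phi> =
     \<lparr>carrier = (SIGMA i:UNIV. carrier (A i)) // limit_rel A \<phi>,
      monoid.mult = (\<lambda>C D. \<Union>(i, x)\<in>C. \<Union>(j, y)\<in>D. limit_class A \<phi> (max i j)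
         (transition \<phi> i (max i j) x \<otimes>\<^bsub>A (max i j)\<^esub> transition \<phi> j (max i j) y)),
      one = limit_class A \<phi> 0 \<one>\<^bsub>A 0\<^esub>\<rparr>"

definition limit_cone ::
  "(nat \<Rightarrow> ('a, 'b) monoid_scheme) \<Rightarrow> (nat \<Rightarrow> 'a \<Rightarrow> 'a) \<Rightarrow> (nat \<Rightarrow> 'a set) \<Rightarrow> (nat \<times> 'a) set set" where
  "limit_cone A \<phi> P = {limit_class A \<phi> i x | i x. x \<in> P i}"

definition simplicial_sequence :: "(nat \<Rightarrow> nat) \<Rightarrow> (nat \<Rightarrow> (nat \<Rightarrow> int) \<Rightarrow> nat \<Rightarrow> int) \<Rightarrow> bool" where
  "simplicial_sequence m \<phi> \<longleftrightarrow>
     (\<forall>n. \<phi> n \<in> positive_hom (simplicial_group (m n)) (simplicial_cone (m n))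
                   (simplicial_group (m (Suc n))) (simplicial_cone (m (Suc n))))"

definition is_simplicial_limit ::
  "('a, 'b) monoid_scheme \<Rightarrow> 'a set \<Rightarrow> (nat \<Rightarrow> nat) \<Rightarrow> (nat \<Rightarrow> (nat \<Rightarrow> int) \<Rightarrow> nat \<Rightarrow> int) \<Rightarrow> bool" where
  "is_simplicial_limit G P m \<phi> \<longleftrightarrow> simplicial_sequence m \<phi> \<and>
     order_isomorphic G P
       (inductive_limit (\<lambda>n. simplicial_group (m n)) \<phi>)
       (limit_cone (\<lambda>n. simplicial_group (m n)) \<phi> (\<lambda>n. simplicial_cone (m n)))"

definition dimension_group :: "('a, 'b) monoid_scheme \<Rightarrow> 'a set \<Rightarrow> bool" where
  "dimension_group G P \<longleftrightarrow> ordered_abelian_group G P \<and> countable (carrier G) \<and>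
     (\<exists>m \<phi>. is_simplicial_limit G P m \<phi>)"

definition ultrasimplicial :: "('a, 'b) monoid_scheme \<Rightarrow> 'a set \<Rightarrow> bool" where
  "ultrasimplicial G P \<longleftrightarrow> dimension_group G P \<and>
     (\<exists>m \<phi>. is_simplicial_limit G P m \<phi> \<and>
        (\<forall>n. inj_on (\<phi> n) (carrier (simplicial_group (m n)))))"


section \<open>The rationals and the lexicographic cone\<close>

definition rat_group :: "rat monoid" where
  "rat_group = \<lparr>carrier = UNIV, monoid.mult = (+), one = 0\<rparr>"

text \<open>The map \<open>\<iota>\<close> is the fixed embedding of \<open>H\<close> into \<open>rat_group\<close>.\<close>

definition strict_first_cone ::
  "('h, 'c) monoid_scheme \<Rightarrow> ('k, 'd) monoid_scheme \<Rightarrow> ('h \<Rightarrow> rat) \<Rightarrow> ('h \<times> 'k) set" where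
  "strict_first_cone H K \<iota> = {(h, k). h \<in> carrier H \<and> k \<in> carrier K \<and> 0 < \<iota> h} \<union> {\<one>\<^bsub>H \<times>\<times> K\<^esub>}"

end

theory Submission
  imports Defs
begin

text \<open>
  The groups are written additively in the comments of this theory.

  Suppose that \<open>H \<times> K\<close> were ultrasimplicial. Then any finite set of elements lies in the image \<open>E\<close> of
  a single injective stage \<open>\<int>\<^sup>m\<close> in which the positive ones among them have non-negative
  coordinates (\<open>ultrasimplicial_finite_stage\<close>). Fix \<open>h \<in> H\<close> with \<open>h > 0\<close> and a maximal
  independent set \<open>X\<close> in \<open>K\<close>. If the stage contains \<open>(h, 0)\<close> and all \<open>(h, x)\<close> and \<open>(h, - x)\<close> with \<open>x \<in> X\<close>,
  then \<open>m \<ge> 2\<close>, every basis vector has an \<open>H\<close>-component \<open>t i > 0\<close>, and all coordinates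
  \<open>w i\<close> of \<open>(h, 0)\<close> are strictly positive (\<open>finite_stage_positivity\<close>).

  Let \<open>c\<close> be the primitive vector proportional to \<open>w\<close>; it spans the intersection of \<open>E\<close> with \<open>H\<close>. The
  \<open>H\<close>-components of vectors in the stage form a cyclic subgroup of the rationals, and the
  \<open>H\<close>-component of \<open>c\<close>, being a sum of \<open>m \<ge> 2\<close> positive members of this cyclic group, is not one of
  its generators. So it equals \<open>p\<close> times the \<open>H\<close>-component of a vector \<open>v\<close>, for some prime \<open>p\<close>
  (\<open>positive_combination_divisible_by_prime\<close>). The number of times the generator goes into it is the
  index of \<open>(E \<inter> H) \<oplus> (E \<inter> K)\<close> in \<open>E\<close>: positivity forces \<open>E\<close> not to be the direct sum of
  its intersections with \<open>H\<close> and \<open>K\<close>.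

  The hypothesis on types forces the opposite for a suitable stage. If \<open>p\<close> occurs as above,
  then \<open>c\<close> has an \<open>H\<close>-component divisible by \<open>p\<close> in \<open>H\<close>, and \<open>c - p v\<close> lies in \<open>E \<inter> K\<close> and is divisible by
  \<open>p\<close> in \<open>K\<close>, but not in \<open>E \<inter> K\<close>, since \<open>c\<close> is primitive. The first is impossible if \<open>h\<close> has height
  zero at \<open>p\<close>. The second is impossible if every \<open>x \<in> X\<close> has height zero at \<open>p\<close> in the
  rank-one quotient of \<open>K\<close> in which the other members of \<open>X\<close> vanish, because then \<open>X\<close> generates \<open>K\<close>
  up to multipliers prime to \<open>p\<close>. The hypothesis says that one of the two holds for
  almost all \<open>p\<close>, and that at each remaining prime the heights on one of the two sides are at
  least finite. In that case finitely many further elements in the stage restore the argument: a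
  root of \<open>h\<close> of height zero, or representatives of the elements of \<open>K\<close> with bounded
  \<open>p\<close>-denominators modulo the group generated by \<open>X\<close>
  (\<open>finite_set_forcing_p_purity\<close>, \<open>finite_set_excluding_prime\<close>). Only finitely many primes require this,
  so a single stage excludes all of them (\<open>finite_stage_contradiction\<close>).
\<close>

section \<open>Heights in torsion-free groups\<close>

lemma torsion_freeD:
  assumes "torsion_free G" "a \<in> carrier G" "(n::int) \<noteq> 0" "a [^]\<^bsub>G\<^esub> n = \<one>\<^bsub>G\<^esub>"
  shows "a = \<one>\<^bsub>G\<^esub>"
proof -
  have "n \<noteq> 0 \<longrightarrow> a [^]\<^bsub>G\<^esub> n = \<one>\<^bsub>G\<^esub> \<longrightarrow> a = \<one>\<^bsub>G\<^esub>"
    using assms(1,2) unfolding torsion_free_def by (elim ballE allE) auto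
  then show ?thesis using assms by simp
qed

lemma enat_eqI_lower_bounds:
  assumes "\<And>m. enat m \<le> x \<longleftrightarrow> enat m \<le> y"
  shows "x = y"
proof (cases x; cases y)
  fix i j assume "x = enat i" "y = enat j"
  then show ?thesis using assms[of i] assms[of j] by simp
next
  fix i assume "x = enat i" "y = \<infinity>"
  then show ?thesis using assms[of "Suc i"] by simp
next
  fix j assume "x = \<infinity>" "y = enat j"
  then show ?thesis using assms[of "Suc j"] by simp
qed simp

lemma (in comm_group) torsion_free_int_pow_cancel:
  assumes "torsion_free G" "a \<in> carrier G" "b \<in> carrier G" "(n::int) \<noteq> 0"
    and eq: "a [^] n = b [^] n"
  shows "a = b"
proof -
  have "(a \<otimes> inv b) [^] n = \<one>"
    using assms by (simp add: int_pow_mult_distrib m_comm int_pow_inv)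
  then have "a \<otimes> inv b = \<one>"
    using assms unfolding torsion_free_def by blast
  then show ?thesis
    using assms by (metis inv_equality inv_closed inv_inv)
qed

lemma (in group) mem_multiples_iff:
  "a \<in> multiples G n \<longleftrightarrow> (\<exists>b\<in>carrier G. a = b [^] int n)"
  unfolding multiples_def by (auto simp: int_pow_int)

lemma (in group) multiples_dvd_mono:
  assumes "m dvd n"
  shows "multiples G n \<subseteq> multiples G m"
proof
  fix a assume "a \<in> multiples G n"
  then obtain b where b: "b \<in> carrier G" "a = b [^] int n"
    unfolding mem_multiples_iff by blast
  from assms obtain k where "n = k * m" by (metis dvd_def mult.commute)
  with b have "a = (b [^] int k) [^] int m" by (simp add: int_pow_pow)
  with b show "a \<in> multiples G m" unfolding mem_multiples_iff by blast
qed

text \<open>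
  The height is given by a definite description; it is only ever used through this
  characterization by lower bounds, which also settles the infinite case.
\<close>

lemma (in group) enat_le_p_height_iff:
  assumes a: "a \<in> carrier G"
  shows "enat m \<le> p_height G a p \<longleftrightarrow> a \<in> multiples G (p ^ m)"
proof -
  define Q where "Q m \<longleftrightarrow> a \<in> multiples G (p ^ m)" for m
  have Q0: "Q 0" using a by (auto simp: Q_def multiples_def)
  have mono: "Q n \<Longrightarrow> m \<le> n \<Longrightarrow> Q m" for m n
    unfolding Q_def using multiples_dvd_mono le_imp_power_dvd by blast
  show ?thesis
  proof (cases "\<exists>m. Q m \<and> \<not> Q (Suc m)")
    case True
    then obtain h where h: "Q h" "\<not> Q (Suc h)" by blast
    have "(THE m. Q m \<and> \<not> Q (Suc m)) = h"
      using h mono by (intro the_equality) (auto, metis not_less_eq_eq order.antisym)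
    then have "p_height G a p = enat h"
      using True by (simp add: p_height_def Q_def)
    moreover have "Q m \<longleftrightarrow> m \<le> h"
      using h mono by (metis not_less_eq_eq)
    ultimately show ?thesis by (simp add: Q_def)
  next
    case False
    then have "Q m" using Q0 by (induction m) auto
    moreover from False have "p_height G a p = \<infinity>"
      unfolding p_height_def Q_def by (intro if_not_P) blast
    ultimately show ?thesis by (simp add: Q_def)
  qed
qed

lemma (in comm_group) coprime_int_pow_mem_multiples_iff:
  assumes "a \<in> carrier G" "coprime n (int q)"
  shows "a [^] n \<in> multiples G q \<longleftrightarrow> a \<in> multiples G q"
proof -
  show ?thesis
  proof
    assume "a \<in> multiples G q"
    then obtain b where b: "b \<in> carrier G" "a = b [^] int q" unfolding mem_multiples_iff by blast
    then have "a [^] n = (b [^] n) [^] int q" by (simp add: int_pow_pow mult.commute)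
    with b show "a [^] n \<in> multiples G q" unfolding mem_multiples_iff by blast
  next
    assume "a [^] n \<in> multiples G q"
    then obtain b where b: "b \<in> carrier G" "a [^] n = b [^] int q" unfolding mem_multiples_iff by blast
    obtain u v where uv: "u * n + v * int q = 1"
      using assms(2) by (metis bezout_int coprime_imp_gcd_eq_1)
    have "a = a [^] (n * u + int q * v)" using assms uv by (simp add: mult.commute)
    also have "\<dots> = (b [^] int q) [^] u \<otimes> a [^] (int q * v)"
      using assms b by (simp add: int_pow_mult flip: int_pow_pow)
    also have "\<dots> = (b [^] u \<otimes> a [^] v) [^] int q"
      using assms b by (simp add: int_pow_distrib int_pow_pow mult.commute)
    finally show "a \<in> multiples G q" unfolding mem_multiples_iff using assms b by blast
  qed
qed

text \<open>
  Writing \<open>n = p ^ v * n'\<close> with \<open>p\<close> not dividing \<open>n'\<close>, the factor \<open>n'\<close> is harmless by Bezout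
  and each factor \<open>p\<close> raises the height by exactly one, because roots are unique in a
  torsion-free group.
\<close>

lemma (in comm_group) p_height_int_pow:
  assumes "torsion_free G" "a \<in> carrier G" "(n::int) \<noteq> 0" "prime p"
  shows "p_height G (a [^] n) p = p_height G a p + enat (multiplicity (int p) n)"
proof -
  define v where "v = multiplicity (int p) n"
  have "\<not> is_unit (int p)" using assms(4) prime_gt_1_nat by fastforce
  then obtain n' where n': "n = n' * int p ^ v" "\<not> int p dvd n'"
    using multiplicity_decompose'[of n "int p"] assms(3) unfolding v_def by (metis mult.commute)
  have cop: "coprime n' (int (p ^ m))" for m
    using n'(2) assms(4) by (simp add: coprime_commute[of n'] prime_imp_coprime)
  have "enat m \<le> p_height G (a [^] n) p \<longleftrightarrow> enat m \<le> p_height G a p + enat v" for m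
  proof (cases "m \<le> v")
    case True
    have "a [^] n = (a [^] n') [^] int (p ^ v)" using assms n' by (simp add: int_pow_pow)
    then have "a [^] n \<in> multiples G (p ^ v)" using assms unfolding mem_multiples_iff by blast
    then have "a [^] n \<in> multiples G (p ^ m)"
      using multiples_dvd_mono[OF le_imp_power_dvd[OF True]] by blast
    then have "enat m \<le> p_height G (a [^] n) p"
      using assms by (subst enat_le_p_height_iff) auto
    moreover have "enat m \<le> p_height G a p + enat v"
      using True by (cases "p_height G a p") auto
    ultimately show ?thesis by blast
  next
    case False
    then obtain k where k: "m = k + v" by (metis add.commute le_Suc_ex nat_le_linear)
    have "a [^] n \<in> multiples G (p ^ m) \<longleftrightarrow> a [^] n' \<in> multiples G (p ^ k)"
    proof
      assume "a [^] n \<in> multiples G (p ^ m)"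
      then obtain b where b: "b \<in> carrier G" "a [^] n = b [^] int (p ^ m)"
        unfolding mem_multiples_iff by blast
      then have "(a [^] n') [^] int (p ^ v) = (b [^] int (p ^ k)) [^] int (p ^ v)"
        using assms n' k by (simp add: int_pow_pow power_add)
      moreover have "int (p ^ v) \<noteq> 0" using prime_gt_0_nat[OF assms(4)] by simp
      ultimately have "a [^] n' = b [^] int (p ^ k)"
        using assms b torsion_free_int_pow_cancel[OF assms(1)] by blast
      with b show "a [^] n' \<in> multiples G (p ^ k)" unfolding mem_multiples_iff by blast
    next
      assume "a [^] n' \<in> multiples G (p ^ k)"
      then obtain b where b: "b \<in> carrier G" "a [^] n' = b [^] int (p ^ k)"
        unfolding mem_multiples_iff by blast
      have "a [^] n = (a [^] n') [^] int (p ^ v)" using assms n' by (simp add: int_pow_pow)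
      also have "\<dots> = b [^] int (p ^ m)" using b k by (simp add: int_pow_pow power_add)
      finally show "a [^] n \<in> multiples G (p ^ m)" using b unfolding mem_multiples_iff by blast
    qed
    also have "\<dots> \<longleftrightarrow> a \<in> multiples G (p ^ k)"
      using coprime_int_pow_mem_multiples_iff[OF assms(2) cop] .
    finally show ?thesis using assms k
      by (cases "p_height G a p") (auto simp: enat_le_p_height_iff[symmetric])
  qed
  then have "p_height G (a [^] n) p = p_height G a p + enat v"
    by (rule enat_eqI_lower_bounds)
  then show ?thesis unfolding v_def .
qed

lemma (in comm_group) type_of_int_pow:
  assumes "torsion_free G" "a \<in> carrier G" "(n::int) \<noteq> 0"
  shows "type_of G (a [^] n) = type_of G a"
proof -
  have "finite {p. prime p \<and> p dvd nat \<bar>n\<bar>}"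
    using assms(3) by (intro finite_subset[OF _ finite_divisors_nat[of "nat \<bar>n\<bar>"]]) auto
  moreover have "{p. prime p \<and> p_height G (a [^] n) p \<noteq> p_height G a p}
      \<subseteq> {p. prime p \<and> p dvd nat \<bar>n\<bar>}"
  proof (intro Collect_mono impI conjI; elim conjE)
    fix p :: nat assume p: "prime p" "p_height G (a [^] n) p \<noteq> p_height G a p"
    then have "multiplicity (int p) n \<noteq> 0"
      using p_height_int_pow[OF assms] by (metis add.right_neutral zero_enat_def)
    then have "int p dvd n" using not_dvd_imp_multiplicity_0[of "int p" n] by auto
    then show "p dvd nat \<bar>n\<bar>" by (simp add: nat_abs_dvd_iff dvd_nat_abs_iff)
  qed
  ultimately have "finite {p. prime p \<and> p_height G (a [^] n) p \<noteq> p_height G a p}"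
    by (rule rev_finite_subset)
  then have "type_equiv (p_height G (a [^] n)) (p_height G a)"
    unfolding type_equiv_def using p_height_int_pow[OF assms] by (auto simp: plus_eq_infty_iff_enat)
  then show ?thesis unfolding type_of_def by (simp add: htype.abs_eq_iff)
qed

text \<open>
  By the previous lemma the type is constant on commensurable elements, so the arbitrary element
  chosen in \<open>group_type\<close> may be replaced by any convenient one.
\<close>

lemma (in comm_group) group_type_eq_type_of:
  assumes "torsion_free G" "a \<in> carrier G" "a \<noteq> \<one>"
    and rank_one: "\<And>b. b \<in> carrier G \<Longrightarrow> b \<noteq> \<one> \<Longrightarrow>
      \<exists>(m::int) (n::int). m \<noteq> 0 \<and> n \<noteq> 0 \<and> b [^] m = a [^] n"
  shows "group_type G = type_of G a"
proof -
  define b where "b = (SOME a. a \<in> carrier G \<and> a \<noteq> \<one>)"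
  have b: "b \<in> carrier G \<and> b \<noteq> \<one>"
    unfolding b_def using assms(2,3) by (intro someI_ex[where P = "\<lambda>a. a \<in> carrier G \<and> a \<noteq> \<one>"]) blast
  then have "\<exists>(m::int) (n::int). m \<noteq> 0 \<and> n \<noteq> 0 \<and> b [^] m = a [^] n"
    by (intro rank_one) auto
  then obtain m n :: int where mn: "m \<noteq> 0" "n \<noteq> 0" "b [^] m = a [^] n"
    by (elim exE conjE)
  have "type_of G b = type_of G (b [^] m)"
    using b mn type_of_int_pow[OF assms(1), of b m] by metis
  also have "\<dots> = type_of G a"
    using assms mn type_of_int_pow[OF assms(1), of a n] by metis
  finally have "type_of G b = type_of G a" .
  then show ?thesis unfolding group_type_def b_def .
qed

lemma group_type_integer_group: "group_type integer_group = abs_htype (\<lambda>_. 0)"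
proof -
  have cg: "comm_group integer_group"
    by (intro group.group_comm_groupI) auto
  have tf: "torsion_free integer_group"
    by (simp add: torsion_free_def)
  have "group_type integer_group = type_of integer_group 1"
  proof (rule comm_group.group_type_eq_type_of[OF cg tf])
    show "1 \<in> carrier integer_group" "1 \<noteq> \<one>\<^bsub>integer_group\<^esub>" by auto
    fix b :: int assume "b \<noteq> \<one>\<^bsub>integer_group\<^esub>"
    then have "(1::int) \<noteq> 0 \<and> b \<noteq> 0 \<and>
        b [^]\<^bsub>integer_group\<^esub> (1::int) = 1 [^]\<^bsub>integer_group\<^esub> b" by simp
    then show "\<exists>(m::int) (n::int). m \<noteq> 0 \<and> n \<noteq> 0 \<and>
        b [^]\<^bsub>integer_group\<^esub> m = 1 [^]\<^bsub>integer_group\<^esub> n" by blast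
  qed
  also have "\<dots> = abs_htype (\<lambda>_. 0)"
  proof -
    have "p_height integer_group 1 p = 0" if "prime p" for p
    proof (rule ccontr)
      assume "p_height integer_group 1 p \<noteq> 0"
      then have "enat 1 \<le> p_height integer_group 1 p"
        by (cases "p_height integer_group 1 p") (auto simp: zero_enat_def)
      then have "1 \<in> multiples integer_group (p ^ 1)"
        by (subst (asm) group.enat_le_p_height_iff) auto
      then obtain b :: int where "1 = int p * b"
        by (auto simp: group.mem_multiples_iff)
      then have "int p dvd 1" by (metis dvd_triv_left)
      then show False using that prime_gt_1_nat by fastforce
    qed
    then show ?thesis unfolding type_of_def by (simp add: htype.abs_eq_iff type_equivI)
  qed
  finally show ?thesis .
qed

section \<open>Integer combinations and maximal independent sets\<close>

definition int_comb :: "('a, 'b) monoid_scheme \<Rightarrow> 'a set \<Rightarrow> ('a \<Rightarrow> int) \<Rightarrow> 'a" where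
  "int_comb G X c = finprod G (\<lambda>x. x [^]\<^bsub>G\<^esub> c x) X"

context comm_group
begin

lemma int_comb_closed [intro, simp]: "X \<subseteq> carrier G \<Longrightarrow> int_comb G X c \<in> carrier G"
  unfolding int_comb_def by (intro finprod_closed) auto

lemma int_pow_minus_one: "x \<in> carrier G \<Longrightarrow> x [^] (- 1 :: int) = inv x"
  using int_pow_neg[of x 1] by simp

lemma int_comb_add:
  assumes "X \<subseteq> carrier G"
  shows "int_comb G X (\<lambda>x. c x + d x) = int_comb G X c \<otimes> int_comb G X d"
proof -
  have "int_comb G X (\<lambda>x. c x + d x) = (\<Otimes>x\<in>X. x [^] c x \<otimes> x [^] d x)"
    unfolding int_comb_def using assms by (intro finprod_cong') (auto simp: int_pow_mult)
  also have "\<dots> = int_comb G X c \<otimes> int_comb G X d"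
    unfolding int_comb_def using assms by (intro finprod_multf) auto
  finally show ?thesis .
qed

lemma int_comb_pow:
  assumes "finite X" "X \<subseteq> carrier G"
  shows "int_comb G X (\<lambda>x. n * c x) = int_comb G X c [^] (n::int)"
  using assms
proof (induction X rule: finite_induct)
  case empty
  then show ?case by (simp add: int_comb_def)
next
  case (insert x X)
  have pi: "(\<lambda>x. x [^] d x) \<in> X \<rightarrow> carrier G" for d :: "'a \<Rightarrow> int" using insert.prems by auto
  have "int_comb G X c \<in> carrier G" using insert.prems by blast
  then show ?case using insert pi
    by (simp add: int_comb_def int_pow_distrib int_pow_pow mult.commute)
qed

lemma int_comb_mono_neutral:
  assumes "finite X" "X \<subseteq> carrier G" "Z \<subseteq> X"
  shows "int_comb G Z c = int_comb G X (\<lambda>x. if x \<in> Z then c x else 0)"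
  unfolding int_comb_def using assms
  by (intro finprod_mono_neutral_cong_left) auto

lemma int_comb_remove:
  assumes "finite X" "X \<subseteq> carrier G" "x \<in> X"
  shows "int_comb G X c = x [^] c x \<otimes> int_comb G (X - {x}) c"
proof -
  have "X = insert x (X - {x})" using assms by blast
  then have "int_comb G X c = finprod G (\<lambda>x. x [^] c x) (insert x (X - {x}))"
    by (simp add: int_comb_def)
  also have "\<dots> = x [^] c x \<otimes> int_comb G (X - {x}) c"
    unfolding int_comb_def using assms by (intro finprod_insert) auto
  finally show ?thesis .
qed

lemma int_comb_single:
  assumes "finite X" "X \<subseteq> carrier G" "x \<in> X"
  shows "int_comb G X (\<lambda>y. if y = x then n else 0) = x [^] n"
proof -
  have "int_comb G (X - {x}) (\<lambda>y. if y = x then n else 0) = \<one>"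
    unfolding int_comb_def by (intro finprod_one_eqI) auto
  then show ?thesis using assms by (subst int_comb_remove[OF assms]) auto
qed

lemma generate_eq_range_int_comb:
  assumes "finite X" "X \<subseteq> carrier G"
  shows "generate G X = range (int_comb G X)"
proof
  show "generate G X \<subseteq> range (int_comb G X)"
  proof
    fix a assume "a \<in> generate G X"
    then show "a \<in> range (int_comb G X)"
    proof induction
      case one
      have "int_comb G X (\<lambda>_. 0) = \<one>" by (simp add: int_comb_def)
      then show ?case by (metis rangeI)
    next
      case (incl h)
      then show ?case using int_comb_single[OF assms, of h 1] assms by (metis int_pow_1 rangeI subsetD)
    next
      case (inv h)
      have "inv h = h [^] (- 1 :: int)" using assms inv by (auto simp: int_pow_minus_one)
      then show ?case using int_comb_single[OF assms inv, of "-1"] by (metis rangeI)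
    next
      case (eng a b)
      then obtain c d where "a = int_comb G X c" "b = int_comb G X d" by blast
      then have "a \<otimes> b = int_comb G X (\<lambda>x. c x + d x)" using int_comb_add[OF assms(2)] by simp
      then show ?case by (simp only: rangeI)
    qed
  qed
  show "range (int_comb G X) \<subseteq> generate G X"
  proof
    fix a assume "a \<in> range (int_comb G X)"
    then obtain c where a: "a = int_comb G X c" by blast
    have sg: "subgroup (generate G X) G" using assms by (intro generate_is_subgroup)
    have "Z \<subseteq> X \<Longrightarrow> int_comb G Z c \<in> generate G X" if "finite Z" for Z
      using that
    proof (induction Z rule: finite_induct)
      case empty
      then show ?case using subgroup.one_closed[OF sg] by (simp add: int_comb_def)
    next
      case (insert x Z)
      then have "x [^] c x \<in> generate G X"
        using subgroup_int_pow_closed[OF sg] by (auto intro: generate.incl)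
      moreover have "int_comb G (insert x Z) c = x [^] c x \<otimes> int_comb G Z c"
        unfolding int_comb_def using insert assms by (intro finprod_insert) auto
      ultimately show ?case using insert subgroup.m_closed[OF sg] by auto
    qed
    then show "a \<in> generate G X" using a assms by blast
  qed
qed

lemma independent_int_comb_eq_one:
  assumes "independent_in G X" "finite Z" "Z \<subseteq> X" "int_comb G Z c = \<one>" "x \<in> Z"
  shows "c x = 0"
proof -
  have "finite Z \<and> Z \<subseteq> X \<and> finprod G (\<lambda>x. x [^] c x) Z = \<one> \<longrightarrow> (\<forall>x\<in>Z. c x = 0)"
    using assms(1) unfolding independent_in_def by (elim conjE allE)
  then show ?thesis using assms by (simp add: int_comb_def)
qed

text \<open>
  If \<open>k\<close> lies outside \<open>X\<close>, maximality gives a non-trivial relation in \<open>insert k X\<close>. Its coefficient at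
  \<open>k\<close> is non-zero because \<open>X\<close> is independent, and the relation can be solved for a multiple of \<open>k\<close>.
\<close>

lemma max_independent_pow_eq_int_comb:
  assumes max: "max_independent_in G X" and fin: "finite X" and k: "k \<in> carrier G"
  shows "\<exists>(n::int) c. n \<noteq> 0 \<and> k [^] n = int_comb G X c"
proof (cases "k \<in> X")
  case True
  have "X \<subseteq> carrier G" using max by (simp add: max_independent_in_def independent_in_def)
  from int_comb_single[OF fin this True, of 1]
  have "k [^] (1::int) = int_comb G X (\<lambda>y. if y = k then 1 else 0)" by simp
  then show ?thesis by (metis zero_neq_one)
next
  case False
  have X: "X \<subseteq> carrier G" and ind: "independent_in G X"
    using max by (auto simp: max_independent_in_def independent_in_def)
  have "\<not> independent_in G (insert k X)"
    using max False unfolding max_independent_in_def by blast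
  then obtain F and c :: "'a \<Rightarrow> int" and x where F: "finite F" "F \<subseteq> insert k X"
      "finprod G (\<lambda>x. x [^] c x) F = \<one>" "x \<in> F" "c x \<noteq> 0"
    unfolding independent_in_def using X k by blast
  have Fc: "int_comb G F c = \<one>" using F by (simp add: int_comb_def)
  have FC: "F \<subseteq> carrier G" using F X k by blast
  have kF: "k \<in> F" and ck: "c k \<noteq> 0"
  proof -
    show "k \<in> F"
    proof (rule ccontr)
      assume "k \<notin> F"
      then have "F \<subseteq> X" using F by blast
      then show False using independent_int_comb_eq_one[OF ind F(1)] F Fc by metis
    qed
    show "c k \<noteq> 0"
    proof
      assume "c k = 0"
      have "int_comb G (F - {k}) c \<in> carrier G" using FC by (intro int_comb_closed) blast
      with \<open>c k = 0\<close> have "int_comb G (F - {k}) c = \<one>"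
        using int_comb_remove[OF F(1) FC \<open>k \<in> F\<close>, of c] Fc by simp
      moreover have "F - {k} \<subseteq> X" "finite (F - {k})" "x \<in> F - {k}"
        using F \<open>c k = 0\<close> by auto
      ultimately show False using independent_int_comb_eq_one[OF ind] F(5) by metis
    qed
  qed
  have "k [^] c k \<otimes> int_comb G (F - {k}) c = \<one>"
    using int_comb_remove[OF F(1) FC kF, of c] Fc by simp
  moreover have "int_comb G (F - {k}) c \<in> carrier G" using FC by blast
  ultimately have "inv (k [^] c k) = int_comb G (F - {k}) c"
    using k by (intro inv_equality) (auto simp: m_comm)
  then have "k [^] (- c k) = int_comb G (F - {k}) c" using k by (simp add: int_pow_neg)
  also have "\<dots> = int_comb G X (\<lambda>x. if x \<in> F - {k} then c x else 0)"
    using F fin X by (intro int_comb_mono_neutral) auto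
  finally show ?thesis using ck by (metis neg_equal_0_iff_equal)
qed

section \<open>The rank-one quotients\<close>

lemma pure_subgroup_is_subgroup:
  assumes "S \<subseteq> carrier G"
  shows "subgroup (pure_subgroup G S) G"
proof -
  have sg: "subgroup (generate G S) G" using assms by (rule generate_is_subgroup)
  show ?thesis
  proof (rule subgroupI)
    show "pure_subgroup G S \<subseteq> carrier G" by (auto simp: pure_subgroup_def)
    have "\<one> \<in> pure_subgroup G S"
      unfolding pure_subgroup_def using subgroup.one_closed[OF sg]
      by (auto intro!: exI[of _ "1::int"])
    then show "pure_subgroup G S \<noteq> {}" by blast
  next
    fix a assume "a \<in> pure_subgroup G S"
    then obtain n :: int where n: "a \<in> carrier G" "n \<noteq> 0" "a [^] n \<in> generate G S"
      by (auto simp: pure_subgroup_def)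
    then have "inv a [^] n \<in> generate G S"
      using subgroup.m_inv_closed[OF sg] by (simp add: int_pow_inv)
    with n show "inv a \<in> pure_subgroup G S" by (auto simp: pure_subgroup_def)
  next
    fix a b assume "a \<in> pure_subgroup G S" "b \<in> pure_subgroup G S"
    then obtain n m :: int where n: "a \<in> carrier G" "n \<noteq> 0" "a [^] n \<in> generate G S"
      and m: "b \<in> carrier G" "m \<noteq> 0" "b [^] m \<in> generate G S"
      by (auto simp: pure_subgroup_def)
    have "(a \<otimes> b) [^] (n * m) = (a [^] n) [^] m \<otimes> (b [^] m) [^] n"
      using n m by (simp add: int_pow_distrib int_pow_pow mult.commute)
    also have "\<dots> \<in> generate G S"
      using subgroup.m_closed[OF sg subgroup_int_pow_closed[OF sg n(3)]
          subgroup_int_pow_closed[OF sg m(3)]] .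
    finally show "a \<otimes> b \<in> pure_subgroup G S"
      using n m by (auto simp: pure_subgroup_def intro!: exI[of _ "n * m"])
  qed
qed

lemma rcos_pow:
  assumes "subgroup N G" "a \<in> carrier G"
  shows "(N #> a) [^]\<^bsub>G Mod N\<^esub> (n::int) = N #> (a [^] n)"
  using assms normal.FactGroup_int_pow[OF subgroup_imp_normal[OF assms(1)]] by simp

lemma rcos_eq_iff_mem:
  assumes "subgroup N G" "a \<in> carrier G"
  shows "N #> a = N \<longleftrightarrow> a \<in> N"
  using assms coset_join1 coset_join2 subgroup.subset by metis

lemma torsion_free_Mod_pure:
  assumes "S \<subseteq> carrier G"
  shows "torsion_free (G Mod pure_subgroup G S)"
  unfolding torsion_free_def
proof (intro ballI allI impI)
  let ?Y = "pure_subgroup G S"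
  have Y: "subgroup ?Y G" using assms by (rule pure_subgroup_is_subgroup)
  fix q and n :: int
  assume "q \<in> carrier (G Mod ?Y)" "n \<noteq> 0" "q [^]\<^bsub>G Mod ?Y\<^esub> n = \<one>\<^bsub>G Mod ?Y\<^esub>"
  then obtain a where a: "a \<in> carrier G" "q = ?Y #> a" "?Y #> (a [^] n) = ?Y"
    using rcos_pow[OF Y] by (auto simp: carrier_FactGroup)
  then have "a [^] n \<in> ?Y" using rcos_eq_iff_mem[OF Y] by simp
  then obtain m :: int where "m \<noteq> 0" "(a [^] n) [^] m \<in> generate G S"
    by (auto simp: pure_subgroup_def)
  then have "a \<in> ?Y" using a \<open>n \<noteq> 0\<close>
    by (auto simp: pure_subgroup_def int_pow_pow intro!: exI[of _ "n * m"])
  then show "q = \<one>\<^bsub>G Mod ?Y\<^esub>" using a rcos_eq_iff_mem[OF Y] by simp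
qed

lemma independent_not_in_pure:
  assumes "independent_in G X" "finite X" "x \<in> X"
  shows "x \<notin> pure_subgroup G (X - {x})"
proof
  have X: "X \<subseteq> carrier G" using assms by (simp add: independent_in_def)
  assume "x \<in> pure_subgroup G (X - {x})"
  then obtain n :: int where n: "n \<noteq> 0" "x [^] n \<in> generate G (X - {x})"
    by (auto simp: pure_subgroup_def)
  then obtain c where c: "x [^] n = int_comb G (X - {x}) c"
    using generate_eq_range_int_comb[of "X - {x}"] assms(2) X by blast
  \<comment> \<open>The relation obtained by bringing \<open>n x = \<Sum>y. c y * y\<close> to one side.\<close>
  define d where "d y = (if y = x then n else - c y)" for y
  have "int_comb G (X - {x}) d = int_comb G (X - {x}) (\<lambda>y. (- 1) * c y)"
    unfolding int_comb_def d_def using X by (intro finprod_cong') auto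
  also have "\<dots> = inv (int_comb G (X - {x}) c)"
    using assms(2) X int_pow_minus_one[OF int_comb_closed[of "X - {x}" c]]
    by (subst int_comb_pow) auto
  finally have "int_comb G X d = x [^] n \<otimes> inv (x [^] n)"
    using int_comb_remove[OF assms(2) X assms(3), of d] c by (simp add: d_def)
  also have "\<dots> = \<one>" using assms X by auto
  finally have "d x = 0" using independent_int_comb_eq_one[OF assms(1,2) subset_refl] assms(3) by blast
  with n show False by (simp add: d_def)
qed

text \<open>
  The quotient by \<open>Y\<close> kills every basis element except \<open>x\<close>, so it reads off the coefficient
  at \<open>x\<close>.
\<close>

lemma rcos_pow_eq_coefficient_pow:
  assumes "finite X" "X \<subseteq> carrier G" "x \<in> X" "k \<in> carrier G" "k [^] (n::int) = int_comb G X c"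
  defines "Y \<equiv> pure_subgroup G (X - {x})"
  shows "(Y #> k) [^]\<^bsub>G Mod Y\<^esub> n = (Y #> x) [^]\<^bsub>G Mod Y\<^esub> c x"
proof -
  have sY: "X - {x} \<subseteq> carrier G" using assms by blast
  have Y: "subgroup Y G" unfolding Y_def using sY by (rule pure_subgroup_is_subgroup)
  have x: "x \<in> carrier G" using assms by blast
  have "int_comb G (X - {x}) c \<in> generate G (X - {x})"
    using generate_eq_range_int_comb[of "X - {x}"] assms(1) sY by blast
  then have mem: "int_comb G (X - {x}) c \<in> Y"
    unfolding Y_def pure_subgroup_def using sY by (auto intro!: exI[of _ "1::int"])
  have "k [^] n = int_comb G (X - {x}) c \<otimes> x [^] c x"
    using int_comb_remove[OF assms(1-3), of c] assms(5) x sY by (simp add: m_comm)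
  then have "Y #> (k [^] n) = (Y #> int_comb G (X - {x}) c) #> (x [^] c x)"
    using coset_mult_assoc[OF subgroup.subset[OF Y]] sY x by simp
  also have "Y #> int_comb G (X - {x}) c = Y" using rcos_eq_iff_mem[OF Y] mem sY by simp
  finally show ?thesis using rcos_pow[OF Y] x assms(4) by simp
qed

lemma group_type_rank_one_quotient:
  assumes max: "max_independent_in G X" and fin: "finite X" and x: "x \<in> X"
  defines "Y \<equiv> pure_subgroup G (X - {x})"
  shows "group_type (G Mod Y) = type_of (G Mod Y) (Y #> x)"
proof -
  have ind: "independent_in G X" using max by (simp add: max_independent_in_def)
  have X: "X \<subseteq> carrier G" using ind by (simp add: independent_in_def)
  have xC: "x \<in> carrier G" using X x by blast
  have sY: "X - {x} \<subseteq> carrier G" using X by blast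
  have Y: "subgroup Y G" unfolding Y_def using sY by (rule pure_subgroup_is_subgroup)
  have cg: "comm_group (G Mod Y)" using Y by (rule abelian_FactGroup)
  have tf: "torsion_free (G Mod Y)" unfolding Y_def using sY by (rule torsion_free_Mod_pure)
  show ?thesis
  proof (rule comm_group.group_type_eq_type_of[OF cg tf])
    show "Y #> x \<in> carrier (G Mod Y)" using xC by (auto simp: carrier_FactGroup)
    show "Y #> x \<noteq> \<one>\<^bsub>G Mod Y\<^esub>"
      using independent_not_in_pure[OF ind fin x] rcos_eq_iff_mem[OF Y xC] by (simp add: Y_def)
    fix q assume q: "q \<in> carrier (G Mod Y)" "q \<noteq> \<one>\<^bsub>G Mod Y\<^esub>"
    then obtain k where k: "k \<in> carrier G" "q = Y #> k" by (auto simp: carrier_FactGroup)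
    obtain n :: int and c where n: "n \<noteq> 0" "k [^] n = int_comb G X c"
      using max_independent_pow_eq_int_comb[OF max fin k(1)] by blast
    then have eq: "q [^]\<^bsub>G Mod Y\<^esub> n = (Y #> x) [^]\<^bsub>G Mod Y\<^esub> c x"
      using rcos_pow_eq_coefficient_pow[OF fin X x k(1)] k unfolding Y_def by blast
    have "c x \<noteq> 0"
    proof
      assume "c x = 0"
      then have "q [^]\<^bsub>G Mod Y\<^esub> n = \<one>\<^bsub>G Mod Y\<^esub>"
        using eq by simp
      then show False using tf q n unfolding torsion_free_def by blast
    qed
    with eq n show "\<exists>(m::int) (n::int). m \<noteq> 0 \<and> n \<noteq> 0 \<and>
        q [^]\<^bsub>G Mod Y\<^esub> m = (Y #> x) [^]\<^bsub>G Mod Y\<^esub> n" by blast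
  qed
qed

text \<open>
  Comparing heights on both sides of \<open>n k = c x\<close> in the rank-one quotient: a finite height of
  \<open>x\<close> there bounds the \<open>p\<close>-part of the denominator with which \<open>x\<close> can occur in an element of the
  group.
\<close>

lemma prime_power_dvd_coefficient:
  assumes max: "max_independent_in G X" and fin: "finite X" and x: "x \<in> X"
    and p: "prime p" and k: "k \<in> carrier G" "(n::int) \<noteq> 0" "k [^] n = int_comb G X c"
  defines "Y \<equiv> pure_subgroup G (X - {x})"
  assumes t: "p_height (G Mod Y) (Y #> x) p \<le> enat t"
  shows "int p ^ multiplicity (int p) n dvd int p ^ t * c x"
proof (cases "c x = 0")
  case False
  have X: "X \<subseteq> carrier G" using max by (simp add: independent_in_def max_independent_in_def)
  have xC: "x \<in> carrier G" using X x by blast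
  have sY: "X - {x} \<subseteq> carrier G" using X by blast
  have Y: "subgroup Y G" unfolding Y_def using sY by (rule pure_subgroup_is_subgroup)
  have cg: "comm_group (G Mod Y)" using Y by (rule abelian_FactGroup)
  have tf: "torsion_free (G Mod Y)" unfolding Y_def using sY by (rule torsion_free_Mod_pure)
  have car: "Y #> k \<in> carrier (G Mod Y)" "Y #> x \<in> carrier (G Mod Y)"
    using k xC by (auto simp: carrier_FactGroup)
  have "(Y #> k) [^]\<^bsub>G Mod Y\<^esub> n = (Y #> x) [^]\<^bsub>G Mod Y\<^esub> c x"
    using rcos_pow_eq_coefficient_pow[OF fin X x k(1,3)] unfolding Y_def .
  then have "p_height (G Mod Y) (Y #> k) p + enat (multiplicity (int p) n) =
      p_height (G Mod Y) (Y #> x) p + enat (multiplicity (int p) (c x))"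
    using comm_group.p_height_int_pow[OF cg tf car(1) k(2) p]
      comm_group.p_height_int_pow[OF cg tf car(2) False p] by simp
  then have "multiplicity (int p) n \<le> t + multiplicity (int p) (c x)"
    using t by (cases "p_height (G Mod Y) (Y #> k) p"; cases "p_height (G Mod Y) (Y #> x) p") auto
  then have "int p ^ multiplicity (int p) n dvd int p ^ t * int p ^ multiplicity (int p) (c x)"
    by (metis le_imp_power_dvd power_add)
  also have "\<dots> dvd int p ^ t * c x" by (intro mult_dvd_mono multiplicity_dvd) auto
  finally show ?thesis .
qed simp

end

section \<open>Purity at a prime of bounded height\<close>

context comm_group
begin

text \<open>
  If \<open>q k\<close> is an integer combination of \<open>X\<close>, dividing the coefficients by \<open>q\<close> with remainder moves \<open>k\<close>
  by an element of \<open>generate G X\<close> to some \<open>s\<close> for which \<open>q s\<close> has coefficients in \<open>{0..<q}\<close>. There are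
  finitely many such combinations, and \<open>s\<close> is determined by \<open>q s\<close>.
\<close>

lemma finite_coset_representatives_of_roots:
  assumes tf: "torsion_free G" and fin: "finite X" and X: "X \<subseteq> carrier G" and q: "q > (0::nat)"
  obtains S where "finite S" "S \<subseteq> carrier G"
    "\<And>k. k \<in> carrier G \<Longrightarrow> k [^] int q \<in> generate G X \<Longrightarrow> \<exists>g\<in>generate G X. \<exists>s\<in>S. k = g \<otimes> s"
proof
  define R where "R = int_comb G X ` (X \<rightarrow>\<^sub>E {0..<int q})"
  define S where "S = {k \<in> carrier G. k [^] int q \<in> R}"
  show "S \<subseteq> carrier G" by (auto simp: S_def)
  have "finite R" unfolding R_def using fin by (intro finite_imageI finite_PiE) auto
  moreover have "inj_on (\<lambda>k. k [^] int q) S"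
    using torsion_free_int_pow_cancel[OF tf, where n = "int q"] q by (auto simp: inj_on_def S_def)
  moreover have "(\<lambda>k. k [^] int q) ` S \<subseteq> R" by (auto simp: S_def)
  ultimately show "finite S" using finite_subset finite_imageD by blast
  fix k assume k: "k \<in> carrier G" "k [^] int q \<in> generate G X"
  then obtain c where c: "k [^] int q = int_comb G X c"
    using generate_eq_range_int_comb[OF fin X] by blast
  define g where "g = int_comb G X (\<lambda>x. c x div int q)"
  define s where "s = inv g \<otimes> k"
  have g: "g \<in> generate G X" "g \<in> carrier G"
    using generate_eq_range_int_comb[OF fin X] X by (auto simp: g_def)
  have sC: "s \<in> carrier G" using g k by (simp add: s_def)
  have "int_comb G X c = int_comb G X (\<lambda>x. int q * (c x div int q) + c x mod int q)"
    by simp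
  also have "\<dots> = g [^] int q \<otimes> int_comb G X (\<lambda>x. c x mod int q)"
    unfolding g_def int_comb_add[OF X] int_comb_pow[OF fin X] ..
  also have "int_comb G X (\<lambda>x. c x mod int q) = int_comb G X (restrict (\<lambda>x. c x mod int q) X)"
    unfolding int_comb_def using X by (intro finprod_cong') auto
  finally have "s [^] int q = inv (g [^] int q) \<otimes>
      (g [^] int q \<otimes> int_comb G X (restrict (\<lambda>x. c x mod int q) X))"
    using g k c by (simp add: s_def int_pow_distrib int_pow_inv)
  also have "\<dots> = int_comb G X (restrict (\<lambda>x. c x mod int q) X)"
    using g X by (simp add: inv_solve_left')
  also have "\<dots> \<in> R" unfolding R_def using q by (intro imageI) auto
  finally have "s \<in> S" using sC by (simp add: S_def)
  moreover have "k = g \<otimes> s" using g k by (simp add: s_def flip: m_assoc)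
  ultimately show "\<exists>g\<in>generate G X. \<exists>s\<in>S. k = g \<otimes> s" using g by blast
qed

text \<open>
  All \<open>p\<close>-denominators with respect to \<open>X\<close> are bounded by \<open>p ^ t\<close>: some multiple of \<open>k\<close> lies in
  \<open>generate G X\<close>, and the part of the multiplier that exceeds \<open>p ^ t\<close> divides all coefficients
  and can be cancelled.
\<close>

lemma exists_coprime_pow_mem_generate:
  assumes tf: "torsion_free G" and max: "max_independent_in G X" and fin: "finite X"
    and p: "prime p"
    and t: "\<And>x. x \<in> X \<Longrightarrow>
      p_height (G Mod pure_subgroup G (X - {x})) (pure_subgroup G (X - {x}) #> x) p \<le> enat t"
    and k: "k \<in> carrier G"
  shows "\<exists>n::int. \<not> int p dvd n \<and> (k [^] n) [^] int (p ^ t) \<in> generate G X"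
proof -
  have X: "X \<subseteq> carrier G" using max by (simp add: independent_in_def max_independent_in_def)
  obtain n :: int and c where n: "n \<noteq> 0" "k [^] n = int_comb G X c"
    using max_independent_pow_eq_int_comb[OF max fin k] by blast
  define v where "v = multiplicity (int p) n"
  have "\<not> is_unit (int p)" using p prime_gt_1_nat by fastforce
  then obtain n' where n': "n = n' * int p ^ v" "\<not> int p dvd n'"
    using multiplicity_decompose'[of n "int p"] n unfolding v_def by (metis mult.commute)
  have "\<forall>x. \<exists>b. x \<in> X \<longrightarrow> int p ^ t * c x = int p ^ v * b"
    using prime_power_dvd_coefficient[OF max fin _ p k n t] unfolding v_def by (metis dvdE)
  then obtain b where b: "\<And>x. x \<in> X \<Longrightarrow> int p ^ t * c x = int p ^ v * b x" by metis
  have "((k [^] n') [^] int (p ^ t)) [^] (int p ^ v) = (k [^] n) [^] (int p ^ t)"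
    using k n' by (simp add: int_pow_pow mult_ac)
  also have "\<dots> = int_comb G X (\<lambda>x. int p ^ t * c x)"
    using n int_comb_pow[OF fin X] by simp
  also have "\<dots> = int_comb G X (\<lambda>x. int p ^ v * b x)"
    unfolding int_comb_def using b X by (intro finprod_cong') auto
  also have "\<dots> = int_comb G X b [^] (int p ^ v)" using int_comb_pow[OF fin X] .
  finally have "(k [^] n') [^] int (p ^ t) = int_comb G X b"
    using torsion_free_int_pow_cancel[OF tf, of "(k [^] n') [^] int (p ^ t)" "int_comb G X b"
        "int p ^ v"] k X p prime_gt_0_nat[OF p] by simp
  then show ?thesis using n' generate_eq_range_int_comb[OF fin X] by blast
qed

lemma subgroup_mem_of_coprime_pows:
  assumes L: "subgroup L G" and k: "k \<in> carrier G"
    and "k [^] (m::int) \<in> L" "k [^] (n::int) \<in> L" "coprime m n"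
  shows "k \<in> L"
proof -
  obtain u v where "u * m + v * n = 1"
    using assms(5) by (metis bezout_int coprime_imp_gcd_eq_1)
  then have "k = k [^] (m * u + n * v)" using k by (simp add: mult.commute)
  also have "\<dots> = (k [^] m) [^] u \<otimes> (k [^] n) [^] v" using k by (simp add: int_pow_mult int_pow_pow)
  also have "\<dots> \<in> L"
    using subgroup.m_closed[OF L subgroup_int_pow_closed[OF L] subgroup_int_pow_closed[OF L]] assms
    by blast
  finally show ?thesis .
qed

text \<open>
  When the heights at \<open>p\<close> are bounded by \<open>t\<close>, the group is, up to multipliers prime to \<open>p\<close>, a finite
  extension of \<open>generate G X\<close>. A subgroup that contains \<open>X\<close> and the finitely many representatives
  therefore already contains everything locally at \<open>p\<close>, and so \<open>p k \<in> L\<close> forces \<open>k \<in> L\<close>. For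
  \<open>t = 0\<close> no representatives are required. This matters because infinitely many primes must be handled
  by one finite set.
\<close>

lemma finite_set_forcing_p_purity:
  assumes tf: "torsion_free G" and max: "max_independent_in G X" and fin: "finite X"
    and p: "prime p"
    and t: "\<And>x. x \<in> X \<Longrightarrow>
      p_height (G Mod pure_subgroup G (X - {x})) (pure_subgroup G (X - {x}) #> x) p \<le> enat t"
  obtains S where "finite S" "S \<subseteq> carrier G" "t = 0 \<Longrightarrow> S = {}"
    "\<And>L k. subgroup L G \<Longrightarrow> X \<subseteq> L \<Longrightarrow> S \<subseteq> L \<Longrightarrow> k \<in> carrier G \<Longrightarrow> k [^] int p \<in> L \<Longrightarrow> k \<in> L"
proof -
  have X: "X \<subseteq> carrier G" using max by (simp add: independent_in_def max_independent_in_def)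
  have "p ^ t > 0" using p prime_gt_0_nat by simp
  then obtain R where R: "finite R" "R \<subseteq> carrier G"
    "\<And>k. k \<in> carrier G \<Longrightarrow> k [^] int (p ^ t) \<in> generate G X \<Longrightarrow>
       \<exists>g\<in>generate G X. \<exists>s\<in>R. k = g \<otimes> s"
    using finite_coset_representatives_of_roots[OF tf fin X] by metis
  define S where "S = (if t = 0 then {} else R)"
  have main: "k \<in> L" if L: "subgroup L G" "X \<subseteq> L" "S \<subseteq> L" and k: "k \<in> carrier G" "k [^] int p \<in> L"
    for L k
  proof -
    have gL: "generate G X \<subseteq> L" using L generate_subgroup_incl by blast
    obtain n :: int where n: "\<not> int p dvd n" "(k [^] n) [^] int (p ^ t) \<in> generate G X"
      using exists_coprime_pow_mem_generate[OF tf max fin p t k(1)] by blast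
    have "k [^] n \<in> L"
    proof (cases "t = 0")
      case True
      then show ?thesis using n gL k by auto
    next
      case False
      then obtain g s where "g \<in> generate G X" "s \<in> S" "k [^] n = g \<otimes> s"
        using R(3)[of "k [^] n"] n k by (auto simp: S_def)
      then show ?thesis using subgroup.m_closed[OF L(1), of g s] L(3) gL by auto
    qed
    moreover have "coprime n (int p)"
      using n p by (simp add: coprime_commute[of n] prime_imp_coprime)
    ultimately show ?thesis using subgroup_mem_of_coprime_pows[OF L(1) k(1)] k(2) by blast
  qed
  show ?thesis
    by (rule that[of S]) (use R main in \<open>auto simp: S_def split: if_splits\<close>)
qed

end

section \<open>The type hypothesis in terms of heights\<close>

lemma Sup_fin_abs_htype:
  assumes "finite I" "I \<noteq> {}"
  shows "Sup_fin ((\<lambda>i. abs_htype (f i)) ` I) = abs_htype (\<lambda>p. Max ((\<lambda>i. f i p) ` I))"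
  using assms
proof (induction I rule: finite_ne_induct)
  case (insert i I)
  have "Sup_fin ((\<lambda>i. abs_htype (f i)) ` insert i I)
      = sup (abs_htype (f i)) (Sup_fin ((\<lambda>i. abs_htype (f i)) ` I))"
    using insert by (simp add: Sup_fin.insert)
  also have "\<dots> = abs_htype (\<lambda>p. Max ((\<lambda>i. f i p) ` insert i I))"
    using insert by (simp add: sup_htype.abs_eq Max_insert)
  finally show ?case .
qed simp

lemma (in comm_group) outer_type_eq_sup_heights:
  assumes tf: "torsion_free G" and rank: "finite_rank G" and nt: "carrier G \<noteq> {\<one>}"
  obtains X where "finite X" "max_independent_in G X" "X \<noteq> {}"
    "outer_type G = abs_htype (\<lambda>p. Max ((\<lambda>x.
       p_height (G Mod pure_subgroup G (X - {x})) (pure_subgroup G (X - {x}) #> x) p) ` X))"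
proof
  define X where "X = (SOME X. finite X \<and> max_independent_in G X)"
  have "\<exists>X. finite X \<and> max_independent_in G X"
    using rank unfolding finite_rank_def has_rank_def by blast
  then have X: "finite X \<and> max_independent_in G X" unfolding X_def by (rule someI_ex)
  then show fin: "finite X" and max: "max_independent_in G X" by auto
  show ne: "X \<noteq> {}"
  proof
    assume "X = {}"
    obtain k where k: "k \<in> carrier G" "k \<noteq> \<one>" using nt by blast
    obtain n :: int and c where "n \<noteq> 0" "k [^] n = int_comb G X c"
      using max_independent_pow_eq_int_comb[OF max fin k(1)] by blast
    then show False
      using \<open>X = {}\<close> k tf unfolding torsion_free_def by (auto simp: int_comb_def)
  qed
  have "outer_type G = outer_type_wrt G X" by (simp add: outer_type_def X_def)
  also have "\<dots> = Sup_fin ((\<lambda>x. type_of (G Mod pure_subgroup G (X - {x}))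
      (pure_subgroup G (X - {x}) #> x)) ` X)"
    unfolding outer_type_wrt_def using group_type_rank_one_quotient[OF max fin]
    by (metis (no_types, lifting) image_cong)
  also have "\<dots> = abs_htype (\<lambda>p. Max ((\<lambda>x.
       p_height (G Mod pure_subgroup G (X - {x})) (pure_subgroup G (X - {x}) #> x) p) ` X))"
    unfolding type_of_def using Sup_fin_abs_htype[OF fin ne] .
  finally show "outer_type G = \<dots>" .
qed

text \<open>
  The type of the integers is the class of the zero sequence, so the minimum of the two height
  sequences vanishes at almost all primes and is finite at the others.
\<close>

lemma type_hypothesis_heights:
  assumes eq: "inf (abs_htype \<alpha>) (abs_htype \<beta>) = group_type integer_group"
  shows "finite {p. prime p \<and> min (\<alpha> p) (\<beta> p) \<noteq> 0}"
    and "prime p \<Longrightarrow> min (\<alpha> p) (\<beta> p) \<noteq> \<infinity>"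
proof -
  have te: "type_equiv (\<lambda>p. min (\<alpha> p) (\<beta> p)) (\<lambda>_. 0)"
    using eq unfolding group_type_integer_group inf_htype.abs_eq htype.abs_eq_iff .
  then show "finite {p. prime p \<and> min (\<alpha> p) (\<beta> p) \<noteq> 0}" by (simp only: type_equiv_def)
  show "min (\<alpha> p) (\<beta> p) \<noteq> \<infinity>" if "prime p"
    using te that unfolding type_equiv_def by (metis infinity_ne_i0)
qed

section \<open>Finite stages of an inductive limit with injective maps\<close>

locale direct_sequence =
  fixes A :: "nat \<Rightarrow> ('a, 'b) monoid_scheme" and \<phi> :: "nat \<Rightarrow> 'a \<Rightarrow> 'a"
  assumes groups: "\<And>n. group (A n)"
    and homs: "\<And>n. \<phi> n \<in> hom (A n) (A (Suc n))"
begin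

lemma transition_refl [simp]: "transition \<phi> i i x = x"
  by (simp add: transition_def)

lemma transition_Suc: "i \<le> k \<Longrightarrow> transition \<phi> i (Suc k) x = \<phi> k (transition \<phi> i k x)"
  by (simp add: transition_def)

lemma transition_trans:
  assumes "i \<le> j" "j \<le> k"
  shows "transition \<phi> j k (transition \<phi> i j x) = transition \<phi> i k x"
  using assms(2,1) by (induction k rule: dec_induct) (simp_all add: transition_Suc)

lemma transition_hom: "i \<le> k \<Longrightarrow> transition \<phi> i k \<in> hom (A i) (A k)"
proof (induction k rule: dec_induct)
  case base
  then show ?case by (auto simp: hom_def)
next
  case (step k)
  then show ?case using homs[of k]
    by (auto simp: hom_def transition_Suc Pi_iff)
qed

lemma transition_closed: "i \<le> k \<Longrightarrow> x \<in> carrier (A i) \<Longrightarrow> transition \<phi> i k x \<in> carrier (A k)"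
  by (rule hom_in_carrier[OF transition_hom])

lemma limit_rel_iff:
  "((i, x), (j, y)) \<in> limit_rel A \<phi> \<longleftrightarrow> x \<in> carrier (A i) \<and> y \<in> carrier (A j) \<and>
     (\<exists>k. i \<le> k \<and> j \<le> k \<and> transition \<phi> i k x = transition \<phi> j k y)"
  by (auto simp: limit_rel_def)

lemma equiv_limit_rel: "equiv (SIGMA i:UNIV. carrier (A i)) (limit_rel A \<phi>)"
proof (rule equivI)
  show "limit_rel A \<phi> \<subseteq> (SIGMA i:UNIV. carrier (A i)) \<times> (SIGMA i:UNIV. carrier (A i))"
    by (auto simp: limit_rel_def)
  show "refl_on (SIGMA i:UNIV. carrier (A i)) (limit_rel A \<phi>)"
    by (rule refl_onI) (auto simp: limit_rel_def)
  show "sym (limit_rel A \<phi>)"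
    by (rule symI) (force simp: limit_rel_def)
  show "trans (limit_rel A \<phi>)"
  proof (rule transI, clarify)
    fix i x j y l z
    assume "((i, x), (j, y)) \<in> limit_rel A \<phi>" "((j, y), (l, z)) \<in> limit_rel A \<phi>"
    then obtain k k' where k: "x \<in> carrier (A i)" "i \<le> k" "j \<le> k" "transition \<phi> i k x = transition \<phi> j k y"
      and k': "z \<in> carrier (A l)" "j \<le> k'" "l \<le> k'" "transition \<phi> j k' y = transition \<phi> l k' z"
      unfolding limit_rel_iff by blast
    define K where "K = max k k'"
    have K: "k \<le> K" "k' \<le> K" by (auto simp: K_def)
    have "transition \<phi> i K x = transition \<phi> j K y"
      using k K transition_trans by metis
    also have "\<dots> = transition \<phi> l K z"
      using k' K transition_trans by metis
    finally show "((i, x), (l, z)) \<in> limit_rel A \<phi>"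
      unfolding limit_rel_iff using k k' K by (meson order_trans)
  qed
qed

lemma limit_class_eq_iff:
  assumes "x \<in> carrier (A i)" "y \<in> carrier (A j)"
  shows "limit_class A \<phi> i x = limit_class A \<phi> j y \<longleftrightarrow>
    (\<exists>k. i \<le> k \<and> j \<le> k \<and> transition \<phi> i k x = transition \<phi> j k y)"
  unfolding limit_class_def
  by (subst eq_equiv_class_iff[OF equiv_limit_rel]) (use assms in \<open>auto simp: limit_rel_iff\<close>)

lemma limit_class_transition:
  assumes "i \<le> k" "x \<in> carrier (A i)"
  shows "limit_class A \<phi> k (transition \<phi> i k x) = limit_class A \<phi> i x"
  by (subst limit_class_eq_iff) (use assms transition_closed in \<open>auto intro!: exI[of _ k]\<close>)

lemma limit_class_closed:
  "x \<in> carrier (A i) \<Longrightarrow> limit_class A \<phi> i x \<in> carrier (inductive_limit A \<phi>)"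
  by (auto simp: inductive_limit_def limit_class_def intro!: quotientI)

lemma limit_class_surj:
  assumes "C \<in> carrier (inductive_limit A \<phi>)"
  obtains i x where "x \<in> carrier (A i)" "C = limit_class A \<phi> i x"
  using assms by (auto simp: inductive_limit_def limit_class_def elim!: quotientE)

text \<open>
  The product in the limit is a union over all pairs of representatives. All members of this
  union coincide: two representatives agree with the given ones after finitely many transitions,
  hence so do their products.
\<close>

lemma limit_class_mult:
  assumes x: "x \<in> carrier (A i)" and y: "y \<in> carrier (A i)"
  shows "limit_class A \<phi> i x \<otimes>\<^bsub>inductive_limit A \<phi>\<^esub> limit_class A \<phi> i y =
    limit_class A \<phi> i (x \<otimes>\<^bsub>A i\<^esub> y)"
proof -
  have const: "limit_class A \<phi> (max j l)
         (transition \<phi> j (max j l) a \<otimes>\<^bsub>A (max j l)\<^esub> transition \<phi> l (max j l) b) =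
       limit_class A \<phi> i (x \<otimes>\<^bsub>A i\<^esub> y)"
    if "(j, a) \<in> limit_class A \<phi> i x" "(l, b) \<in> limit_class A \<phi> i y" for j a l b
  proof -
    from that obtain k k' where
      k: "a \<in> carrier (A j)" "i \<le> k" "j \<le> k" "transition \<phi> i k x = transition \<phi> j k a" and
      k': "b \<in> carrier (A l)" "i \<le> k'" "l \<le> k'" "transition \<phi> i k' y = transition \<phi> l k' b"
      unfolding limit_class_def Image_singleton_iff limit_rel_iff by blast
    define K where "K = max k k'"
    define M where "M = max j l"
    have K: "k \<le> K" "k' \<le> K" "M \<le> K" "j \<le> M" "l \<le> M" "i \<le> K"
      using k k' by (auto simp: K_def M_def)
    have eqx: "transition \<phi> j K a = transition \<phi> i K x"
      using k K transition_trans by metis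
    have eqy: "transition \<phi> l K b = transition \<phi> i K y"
      using k' K transition_trans by metis
    have ab: "transition \<phi> j M a \<in> carrier (A M)" "transition \<phi> l M b \<in> carrier (A M)"
      using k k' K transition_closed by auto
    have "transition \<phi> M K (transition \<phi> j M a \<otimes>\<^bsub>A M\<^esub> transition \<phi> l M b)
        = transition \<phi> j K a \<otimes>\<^bsub>A K\<^esub> transition \<phi> l K b"
      using hom_mult[OF transition_hom[OF K(3)] ab] transition_trans K by simp
    also have "\<dots> = transition \<phi> i K (x \<otimes>\<^bsub>A i\<^esub> y)"
      using hom_mult[OF transition_hom[OF K(6)] x y] eqx eqy by simp
    finally have eq: "transition \<phi> M K (transition \<phi> j M a \<otimes>\<^bsub>A M\<^esub> transition \<phi> l M b)
        = transition \<phi> i K (x \<otimes>\<^bsub>A i\<^esub> y)" .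
    have "limit_class A \<phi> M (transition \<phi> j M a \<otimes>\<^bsub>A M\<^esub> transition \<phi> l M b) =
       limit_class A \<phi> i (x \<otimes>\<^bsub>A i\<^esub> y)"
    proof (subst limit_class_eq_iff)
      show "transition \<phi> j M a \<otimes>\<^bsub>A M\<^esub> transition \<phi> l M b \<in> carrier (A M)"
        using ab by (rule monoid.m_closed[OF group.is_monoid[OF groups]])
      show "x \<otimes>\<^bsub>A i\<^esub> y \<in> carrier (A i)"
        using x y by (rule monoid.m_closed[OF group.is_monoid[OF groups]])
      show "\<exists>k. M \<le> k \<and> i \<le> k \<and>
        transition \<phi> M k (transition \<phi> j M a \<otimes>\<^bsub>A M\<^esub> transition \<phi> l M b) =
        transition \<phi> i k (x \<otimes>\<^bsub>A i\<^esub> y)"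
        using eq K by blast
    qed
    then show ?thesis unfolding M_def .
  qed
  have mem: "(i, x) \<in> limit_class A \<phi> i x" "(i, y) \<in> limit_class A \<phi> i y"
    using x y by (auto simp: limit_class_def limit_rel_iff)
  have "limit_class A \<phi> i x \<otimes>\<^bsub>inductive_limit A \<phi>\<^esub> limit_class A \<phi> i y =
    (\<Union>(j, a)\<in>limit_class A \<phi> i x. \<Union>(l, b)\<in>limit_class A \<phi> i y. limit_class A \<phi> (max j l)
         (transition \<phi> j (max j l) a \<otimes>\<^bsub>A (max j l)\<^esub> transition \<phi> l (max j l) b))"
    by (simp add: inductive_limit_def)
  also have "\<dots> = (\<Union>u\<in>limit_class A \<phi> i x. \<Union>w\<in>limit_class A \<phi> i y.
      limit_class A \<phi> i (x \<otimes>\<^bsub>A i\<^esub> y))"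
    using const by (intro SUP_cong refl) (auto simp: split_beta)
  also have "\<dots> = limit_class A \<phi> i (x \<otimes>\<^bsub>A i\<^esub> y)"
    using mem by auto
  finally show ?thesis .
qed

lemma limit_class_hom: "limit_class A \<phi> i \<in> hom (A i) (inductive_limit A \<phi>)"
  by (rule homI) (auto simp: limit_class_closed limit_class_mult)

lemma transition_inj:
  assumes "\<And>n. inj_on (\<phi> n) (carrier (A n))" "i \<le> k"
  shows "inj_on (transition \<phi> i k) (carrier (A i))"
  using assms(2)
proof (induction k rule: dec_induct)
  case base
  then show ?case by (auto simp: inj_on_def)
next
  case (step k)
  then show ?case using assms(1)[of k] transition_closed[OF step(1)]
    unfolding inj_on_def by (simp add: transition_Suc)
qed

lemma limit_class_inj:
  assumes "\<And>n. inj_on (\<phi> n) (carrier (A n))"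
  shows "inj_on (limit_class A \<phi> i) (carrier (A i))"
proof (rule inj_onI)
  fix x y assume xy: "x \<in> carrier (A i)" "y \<in> carrier (A i)" "limit_class A \<phi> i x = limit_class A \<phi> i y"
  then obtain k where "i \<le> k" "transition \<phi> i k x = transition \<phi> i k y"
    using limit_class_eq_iff by blast
  then show "x = y" using transition_inj[OF assms] xy by (meson inj_onD)
qed

lemma transition_cone:
  assumes "\<And>n. \<phi> n ` P n \<subseteq> P (Suc n)" "i \<le> k" "x \<in> P i"
  shows "transition \<phi> i k x \<in> P k"
  using assms(2)
proof (induction k rule: dec_induct)
  case base
  then show ?case using assms by simp
next
  case (step k)
  then show ?case using assms(1)[of k] by (auto simp: transition_Suc)
qed

end

lemma group_simplicial_group [simp]: "group (simplicial_group m)"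
  by (simp add: simplicial_group_def)

text \<open>
  Every element of a limit of a sequence appears at some stage and stays in all later ones, so
  finitely many elements appear together. Injective transition maps make the maps from the stages
  to the limit injective, so a stage is a subgroup with the basis \<open>simplicial_unit m i\<close>.
\<close>

lemma ultrasimplicial_finite_stage:
  assumes us: "ultrasimplicial G P" and S: "finite S" "S \<subseteq> carrier G"
  obtains m e where "e \<in> hom (simplicial_group m) G"
    "inj_on e (carrier (simplicial_group m))"
    "e ` simplicial_cone m \<subseteq> P"
    "S \<subseteq> e ` carrier (simplicial_group m)"
    "S \<inter> P \<subseteq> e ` simplicial_cone m"
proof -
  obtain m \<phi> where lim: "is_simplicial_limit G P m \<phi>"
    and inj: "\<And>n. inj_on (\<phi> n) (carrier (simplicial_group (m n)))"
    using us unfolding ultrasimplicial_def by blast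
  define A where "A n = simplicial_group (m n)" for n
  define C where "C n = simplicial_cone (m n)" for n
  have pos: "\<phi> n \<in> positive_hom (A n) (C n) (A (Suc n)) (C (Suc n))" for n
    using lim by (simp add: is_simplicial_limit_def simplicial_sequence_def A_def C_def)
  interpret direct_sequence A \<phi>
    by (rule direct_sequence.intro) (use pos in \<open>auto simp: A_def positive_hom_def\<close>)
  have inj': "inj_on (\<phi> n) (carrier (A n))" for n using inj by (simp add: A_def)
  have cone: "\<phi> n ` C n \<subseteq> C (Suc n)" for n using pos by (simp add: positive_hom_def)
  have CA: "C n \<subseteq> carrier (A n)" for n by (auto simp: C_def A_def simplicial_cone_def)
  have "order_isomorphic G P (inductive_limit A \<phi>) (limit_cone A \<phi> C)"
    using lim by (simp add: is_simplicial_limit_def A_def[abs_def] C_def[abs_def])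
  then obtain f g where f: "f \<in> positive_hom G P (inductive_limit A \<phi>) (limit_cone A \<phi> C)"
    and g: "g \<in> positive_hom (inductive_limit A \<phi>) (limit_cone A \<phi> C) G P"
    and gf: "\<And>x. x \<in> carrier G \<Longrightarrow> g (f x) = x"
    and fg: "\<And>y. y \<in> carrier (inductive_limit A \<phi>) \<Longrightarrow> f (g y) = y"
    unfolding order_isomorphic_def by (elim bexE conjE) (rule that, auto)
  have ex: "\<exists>i x. x \<in> carrier (A i) \<and> f s = limit_class A \<phi> i x \<and> (s \<in> P \<longrightarrow> x \<in> C i)"
    if "s \<in> S" for s
  proof (cases "s \<in> P")
    case True
    then have "f s \<in> limit_cone A \<phi> C" using f by (auto simp: positive_hom_def)
    then show ?thesis using CA unfolding limit_cone_def by blast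
  next
    case False
    have "f s \<in> carrier (inductive_limit A \<phi>)"
      using f that S by (auto simp: positive_hom_def hom_def)
    then show ?thesis using False limit_class_surj by metis
  qed
  then obtain i x where ix: "\<And>s. s \<in> S \<Longrightarrow> x s \<in> carrier (A (i s))"
    "\<And>s. s \<in> S \<Longrightarrow> f s = limit_class A \<phi> (i s) (x s)"
    "\<And>s. s \<in> S \<Longrightarrow> s \<in> P \<Longrightarrow> x s \<in> C (i s)"
    by metis
  \<comment> \<open>A stage beyond all those at which the elements of \<open>S\<close> appear.\<close>
  define N where "N = Max (insert 0 (i ` S))"
  have N: "i s \<le> N" if "s \<in> S" for s using that S by (auto simp: N_def)
  define e where "e = g \<circ> limit_class A \<phi> N"
  have e: "e (transition \<phi> (i s) N (x s)) = s" if "s \<in> S" for s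
  proof -
    have "e (transition \<phi> (i s) N (x s)) = g (f s)"
      using limit_class_transition[OF N[OF that] ix(1)[OF that]] ix(2)[OF that] by (simp add: e_def)
    then show ?thesis using gf that S by auto
  qed
  show ?thesis
  proof (rule that[of e "m N"])
    show "e \<in> hom (simplicial_group (m N)) G"
      using hom_compose[OF limit_class_hom, of g G N] g
      by (simp add: positive_hom_def e_def A_def)
    have "inj_on g (carrier (inductive_limit A \<phi>))" using fg by (rule inj_on_inverseI)
    then have "inj_on e (carrier (A N))" unfolding e_def
      using limit_class_inj[OF inj'] limit_class_closed
      by (intro comp_inj_on) (auto intro: inj_on_subset)
    then show "inj_on e (carrier (simplicial_group (m N)))" by (simp add: A_def)
    show "e ` simplicial_cone (m N) \<subseteq> P"
      using g by (auto simp: positive_hom_def e_def limit_cone_def C_def)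
    show "S \<subseteq> e ` carrier (simplicial_group (m N))"
    proof
      fix s assume s: "s \<in> S"
      then have "transition \<phi> (i s) N (x s) \<in> carrier (A N)" using transition_closed N ix by blast
      then show "s \<in> e ` carrier (simplicial_group (m N))" using e[OF s] by (force simp: A_def)
    qed
    show "S \<inter> P \<subseteq> e ` simplicial_cone (m N)"
    proof
      fix s assume s: "s \<in> S \<inter> P"
      then have "transition \<phi> (i s) N (x s) \<in> C N" using transition_cone[of C] cone N ix by auto
      then show "s \<in> e ` simplicial_cone (m N)" using e[of s] s by (force simp: C_def)
    qed
  qed
qed

section \<open>The coordinatewise group of integer vectors\<close>

lemma carrier_simplicial_group: "carrier (simplicial_group m) = ({..<m} \<rightarrow>\<^sub>E UNIV)"
  by (simp add: simplicial_group_def)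

lemma simplicial_mult_nth:
  "i < m \<Longrightarrow> (v \<otimes>\<^bsub>simplicial_group m\<^esub> w) i = v i + w i"
  by (simp add: simplicial_group_def)

lemma simplicial_one_nth: "i < m \<Longrightarrow> \<one>\<^bsub>simplicial_group m\<^esub> i = 0"
  by (simp add: simplicial_group_def)

lemma simplicial_int_pow_nth:
  assumes "v \<in> carrier (simplicial_group m)" "i < m"
  shows "(v [^]\<^bsub>simplicial_group m\<^esub> (n::int)) i = n * v i"
proof -
  have "(\<lambda>v. v i) \<in> hom (simplicial_group m) integer_group"
    using assms(2) by (intro homI) (auto simp: simplicial_mult_nth)
  from hom_int_pow[OF this assms(1)] show ?thesis by (simp add: simplicial_group_def)
qed

lemma simplicial_eqI:
  assumes "v \<in> carrier (simplicial_group m)" "w \<in> carrier (simplicial_group m)"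
    and "\<And>i. i < m \<Longrightarrow> v i = w i"
  shows "v = w"
  using assms by (auto simp: carrier_simplicial_group intro: PiE_ext)

definition simplicial_unit :: "nat \<Rightarrow> nat \<Rightarrow> nat \<Rightarrow> int" where
  "simplicial_unit m i = (\<lambda>j\<in>{..<m}. if j = i then 1 else 0)"

lemma simplicial_unit_closed [simp]: "simplicial_unit m i \<in> carrier (simplicial_group m)"
  by (simp add: simplicial_unit_def carrier_simplicial_group)

lemma simplicial_unit_nth: "j < m \<Longrightarrow> simplicial_unit m i j = (if j = i then 1 else 0)"
  by (simp add: simplicial_unit_def)

lemma group_rat_group: "group rat_group"
  by (rule groupI) (auto simp: rat_group_def intro: exI[of _ "- x" for x])

lemma rat_group_simps [simp]:
  "carrier rat_group = UNIV" "x \<otimes>\<^bsub>rat_group\<^esub> y = x + y" "\<one>\<^bsub>rat_group\<^esub> = 0"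
  by (simp_all add: rat_group_def)

lemma rat_group_int_pow: "x [^]\<^bsub>rat_group\<^esub> (n::int) = of_int n * x"
proof -
  have inv: "inv\<^bsub>rat_group\<^esub> y = - y" for y
    by (rule group.inv_equality[OF group_rat_group]) auto
  have nat: "x [^]\<^bsub>rat_group\<^esub> (k::nat) = of_nat k * x" for k
  proof (induction k)
    case 0
    then show ?case by simp
  next
    case (Suc k)
    then show ?case using monoid.nat_pow_Suc[OF group.is_monoid[OF group_rat_group]]
      by (simp add: algebra_simps)
  qed
  show ?thesis by (simp add: int_pow_def2 nat inv)
qed

text \<open>
  Induction on the number \<open>k\<close> of coordinates that are not yet truncated to \<open>0\<close>.
\<close>

lemma hom_simplicial_rat_eq_sum:
  assumes hom: "\<theta> \<in> hom (simplicial_group m) rat_group" and v: "v \<in> carrier (simplicial_group m)"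
  shows "\<theta> v = (\<Sum>i<m. of_int (v i) * \<theta> (simplicial_unit m i))"
proof -
  interpret Z: group "simplicial_group m" by (simp add: simplicial_group_def)
  define tr where "tr k = (\<lambda>j\<in>{..<m}. if j < k then v j else 0)" for k
  have tr: "tr k \<in> carrier (simplicial_group m)" for k
    by (simp add: tr_def carrier_simplicial_group)
  have "k \<le> m \<Longrightarrow> \<theta> (tr k) = (\<Sum>i<k. of_int (v i) * \<theta> (simplicial_unit m i))" for k
  proof (induction k)
    case 0
    have "tr 0 = \<one>\<^bsub>simplicial_group m\<^esub>"
      by (intro simplicial_eqI[OF tr]) (auto simp: tr_def simplicial_one_nth)
    then show ?case using hom_one[OF hom Z.is_group group_rat_group] by simp
  next
    case (Suc k)
    have "tr (Suc k) = tr k \<otimes>\<^bsub>simplicial_group m\<^esub>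
        simplicial_unit m k [^]\<^bsub>simplicial_group m\<^esub> v k"
    proof (rule simplicial_eqI[OF tr])
      show "tr k \<otimes>\<^bsub>simplicial_group m\<^esub> simplicial_unit m k [^]\<^bsub>simplicial_group m\<^esub> v k
          \<in> carrier (simplicial_group m)"
        using tr by (intro Z.m_closed Z.int_pow_closed) auto
      fix i assume "i < m"
      then show "tr (Suc k) i = (tr k \<otimes>\<^bsub>simplicial_group m\<^esub>
          simplicial_unit m k [^]\<^bsub>simplicial_group m\<^esub> v k) i"
        by (simp add: tr_def simplicial_mult_nth simplicial_int_pow_nth simplicial_unit_nth less_Suc_eq)
    qed
    then have "\<theta> (tr (Suc k)) = \<theta> (tr k) + \<theta> (simplicial_unit m k [^]\<^bsub>simplicial_group m\<^esub> v k)"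
      using hom_mult[OF hom tr] by simp
    also have "\<theta> (simplicial_unit m k [^]\<^bsub>simplicial_group m\<^esub> v k)
        = of_int (v k) * \<theta> (simplicial_unit m k)"
      using hom_int_pow[OF hom _ Z.is_group group_rat_group] by (simp add: rat_group_int_pow)
    finally show ?case using Suc by simp
  qed
  moreover have "tr m = v"
    using v by (intro simplicial_eqI[OF tr]) (auto simp: tr_def)
  ultimately show ?thesis by auto
qed

section \<open>Arithmetic of positive combinations\<close>

lemma gcd_normalisation:
  fixes w :: "nat \<Rightarrow> int"
  assumes "m > 0" "\<And>i. i < m \<Longrightarrow> w i > 0"
  obtains d c where "d > 0" "\<forall>i<m. w i = d * c i \<and> c i > 0"
    "\<forall>q. (\<forall>i<m. q dvd w i) \<longrightarrow> q dvd d"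
    "\<forall>p. prime p \<longrightarrow> (\<exists>i<m. \<not> int p dvd c i)"
proof -
  \<comment> \<open>\<open>d\<close> is the content of \<open>w\<close>, and \<open>c\<close> its primitive part.\<close>
  define d where "d = Gcd (w ` {..<m})"
  define c where "c i = w i div d" for i
  have dw: "d dvd w i" if "i < m" for i unfolding d_def using that by auto
  have "d \<noteq> 0" using dw[of 0] assms(2)[of 0] assms(1) by auto
  moreover have "d \<ge> 0" unfolding d_def by simp
  ultimately have d: "d > 0" by simp
  have wc: "w i = d * c i" if "i < m" for i using dw[OF that] by (simp add: c_def)
  have great: "q dvd d" if "\<And>i. i < m \<Longrightarrow> q dvd w i" for q
    unfolding d_def using that by (intro Gcd_greatest) auto
  have cpos: "c i > 0" if "i < m" for i
    using wc[OF that] assms(2)[OF that] d by (simp add: zero_less_mult_iff)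
  have prim: "\<exists>i<m. \<not> int p dvd c i" if p: "prime p" for p
  proof (rule ccontr)
    assume "\<not> ?thesis"
    then have "d * int p dvd w i" if "i < m" for i using wc[OF that] that by auto
    then have "d * int p dvd d * 1" using great by simp
    then have "int p dvd 1" using d by (subst (asm) dvd_times_left_cancel_iff) auto
    then show False using p prime_gt_1_nat by fastforce
  qed
  show thesis
    by (rule that[OF d]) (use wc cpos great prim in auto)
qed

lemma common_denominator:
  fixes t :: "nat \<Rightarrow> rat"
  shows "\<exists>D U. (D::int) > 0 \<and> (\<forall>i<m. of_int D * t i = of_int (U i :: int))"
proof (induction m)
  case 0
  then show ?case by (intro exI[of _ 1]) auto
next
  case (Suc m)
  then obtain D U where DU: "(D::int) > 0" "\<And>i. i < m \<Longrightarrow> of_int D * t i = of_int (U i :: int)" by blast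
  obtain a b where ab: "t m = of_int a / of_int b" "b > 0"
    by (metis quotient_of_div quotient_of_denom_pos surj_pair)
  have "of_int (D * b) * t i = of_int (if i = m then D * a else b * U i)" if "i < Suc m" for i
    using that DU(2)[of i] ab by (cases "i = m") (auto simp: less_Suc_eq field_simps)
  moreover have "D * b > 0" using DU ab by simp
  ultimately show ?case
    by (intro exI[of _ "D * b"] exI[of _ "\<lambda>i. if i = m then D * a else b * U i"] conjI allI impI)
qed

lemma bezout_finite:
  fixes U :: "nat \<Rightarrow> int"
  shows "\<exists>g v. (\<Sum>i<m. v i * U i) = g \<and> (\<forall>i<m. g dvd U i)"
proof (induction m)
  case (Suc m)
  then obtain g v where g: "(\<Sum>i<m. v i * U i) = g" "\<And>i. i < m \<Longrightarrow> g dvd U i" by blast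
  obtain a b where ab: "a * g + b * U m = gcd g (U m)" by (metis bezout_int)
  have "(\<Sum>i<m. a * v i * U i) = a * g"
    unfolding g(1)[symmetric] sum_distrib_left by (simp only: mult.assoc)
  then have "(\<Sum>i<Suc m. (if i = m then b else a * v i) * U i) = gcd g (U m)"
    using ab by simp
  moreover have "gcd g (U m) dvd U i" if "i < Suc m" for i
    using that g(2)[of i] by (cases "i = m") (auto intro: dvd_trans[of _ g])
  ultimately show ?case by metis
qed simp

text \<open>
  After clearing denominators, the integer combinations of the \<open>t i\<close> are the multiples of some
  \<open>g \<noteq> 0\<close>. Each term \<open>c i * t i\<close> is a positive multiple of \<open>\<bar>g\<bar>\<close>, so the sum of at least two of them
  is \<open>N * g\<close> with \<open>\<bar>N\<bar> \<ge> 2\<close>, and any prime factor of \<open>N\<close> will do.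
\<close>

lemma positive_combination_divisible_by_prime:
  fixes t :: "nat \<Rightarrow> rat" and c :: "nat \<Rightarrow> int"
  assumes m: "m \<ge> 2" and t: "\<And>i. i < m \<Longrightarrow> t i > 0" and c: "\<And>i. i < m \<Longrightarrow> c i > 0"
  obtains p :: nat and v :: "nat \<Rightarrow> int" where
    "prime p" "of_nat p * (\<Sum>i<m. of_int (v i) * t i) = (\<Sum>i<m. of_int (c i) * t i)"
proof -
  obtain D U where D: "(D::int) > 0" and U: "\<And>i. i < m \<Longrightarrow> of_int D * t i = of_int (U i :: int)"
    using common_denominator by blast
  have Upos: "U i > 0" if "i < m" for i
    using U[OF that] t[OF that] D by (metis of_int_0_less_iff mult_pos_pos)
  obtain g v where g: "(\<Sum>i<m. v i * U i) = g" "\<And>i. i < m \<Longrightarrow> g dvd U i"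
    using bezout_finite by blast
  have "g \<noteq> 0" using g(2)[of 0] Upos[of 0] m by auto
  have "g dvd (\<Sum>i<m. c i * U i)" using g by (intro dvd_sum) auto
  then obtain N where N: "(\<Sum>i<m. c i * U i) = g * N" by blast
  have "\<bar>g\<bar> \<le> c i * U i" if "i < m" for i
    using g(2)[OF that] Upos[OF that] c[OF that]
    by (intro zdvd_imp_le) auto
  then have "int m * \<bar>g\<bar> \<le> (\<Sum>i<m. c i * U i)"
    using sum_bounded_below[of "{..<m}" "\<bar>g\<bar>" "\<lambda>i. c i * U i"] by simp
  also have "\<dots> \<le> \<bar>g\<bar> * \<bar>N\<bar>" unfolding N abs_mult[symmetric] by (rule abs_ge_self)
  finally have "int m * \<bar>g\<bar> \<le> \<bar>g\<bar> * \<bar>N\<bar>" .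
  moreover have "2 * \<bar>g\<bar> \<le> int m * \<bar>g\<bar>" using m by (intro mult_right_mono) auto
  ultimately have "\<bar>g\<bar> * 2 \<le> \<bar>g\<bar> * \<bar>N\<bar>" by linarith
  then have "\<bar>N\<bar> \<ge> 2" using \<open>g \<noteq> 0\<close> by simp
  then obtain p where p: "prime p" "p dvd nat \<bar>N\<bar>"
    using prime_factor_nat[of "nat \<bar>N\<bar>"] by force
  then have "int p dvd N" by (simp add: dvd_nat_abs_iff)
  then obtain M where M: "N = int p * M" by (rule dvdE)
  have scale: "of_int D * (\<Sum>i<m. of_int (f i) * t i) = of_int (\<Sum>i<m. f i * U i)" for f
    unfolding sum_distrib_left of_int_sum
    by (intro sum.cong refl) (simp add: mult.left_commute U)
  have "of_int D * (of_nat p * (\<Sum>i<m. of_int (M * v i) * t i)) =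
      of_nat p * (of_int D * (\<Sum>i<m. of_int (M * v i) * t i))" by (rule mult.left_commute)
  also have "\<dots> = of_int (int p * (M * g))"
    unfolding scale using g(1) by (simp add: mult.assoc flip: sum_distrib_left)
  also have "int p * (M * g) = (\<Sum>i<m. c i * U i)" using N M by simp
  also have "of_int \<dots> = of_int D * (\<Sum>i<m. of_int (c i) * t i)" unfolding scale ..
  finally have "of_nat p * (\<Sum>i<m. of_int (M * v i) * t i) = (\<Sum>i<m. of_int (c i) * t i)"
    using D by simp
  then show ?thesis by (rule that[OF p(1), of "\<lambda>i. M * v i"])
qed

section \<open>Primes excluded by a finite stage\<close>

text \<open>
  The two ways in which a subgroup \<open>E\<close> of \<open>H \<times> K\<close> can prevent a prime \<open>p\<close> from arising in
  \<open>positive_combination_divisible_by_prime\<close>: either \<open>E\<close> contains a \<open>p\<close>-power root of \<open>(h, 0)\<close> that is not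
  divisible by \<open>p\<close> in \<open>H\<close>, or the intersection of \<open>E\<close> with \<open>K\<close> is \<open>p\<close>-pure in \<open>K\<close>.
\<close>

definition excludes_prime ::
  "('h, 'c) monoid_scheme \<Rightarrow> ('k, 'd) monoid_scheme \<Rightarrow> 'h \<Rightarrow> ('h \<times> 'k) set \<Rightarrow> nat \<Rightarrow> bool" where
  "excludes_prime H K h E p \<longleftrightarrow>
     (\<exists>h1\<in>carrier H. \<exists>a. h1 [^]\<^bsub>H\<^esub> int (p ^ a) = h \<and> h1 \<notin> multiples H p \<and> (h1, \<one>\<^bsub>K\<^esub>) \<in> E) \<or>
     (\<forall>k\<in>carrier K. (\<one>\<^bsub>H\<^esub>, k [^]\<^bsub>K\<^esub> int p) \<in> E \<longrightarrow> (\<one>\<^bsub>H\<^esub>, k) \<in> E)"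

lemma subgroup_second_slice:
  assumes "group H" "group K" "subgroup E (H \<times>\<times> K)"
  shows "subgroup {k \<in> carrier K. (\<one>\<^bsub>H\<^esub>, k) \<in> E} K"
proof -
  interpret H: group H by fact
  interpret K: group K by fact
  interpret E: subgroup E "H \<times>\<times> K" by fact
  show ?thesis
  proof (rule K.subgroupI)
    have "(\<one>\<^bsub>H\<^esub>, \<one>\<^bsub>K\<^esub>) \<in> E" using E.one_closed by simp
    then show "{k \<in> carrier K. (\<one>\<^bsub>H\<^esub>, k) \<in> E} \<noteq> {}" by blast
  next
    fix a assume "a \<in> {k \<in> carrier K. (\<one>\<^bsub>H\<^esub>, k) \<in> E}"
    then show "inv\<^bsub>K\<^esub> a \<in> {k \<in> carrier K. (\<one>\<^bsub>H\<^esub>, k) \<in> E}"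
      using E.m_inv_closed[of "(\<one>\<^bsub>H\<^esub>, a)"] assms by simp
  next
    fix a b assume "a \<in> {k \<in> carrier K. (\<one>\<^bsub>H\<^esub>, k) \<in> E}" "b \<in> {k \<in> carrier K. (\<one>\<^bsub>H\<^esub>, k) \<in> E}"
    then show "a \<otimes>\<^bsub>K\<^esub> b \<in> {k \<in> carrier K. (\<one>\<^bsub>H\<^esub>, k) \<in> E}"
      using E.m_closed[of "(\<one>\<^bsub>H\<^esub>, a)" "(\<one>\<^bsub>H\<^esub>, b)"] by simp
  qed auto
qed

lemma (in group) finite_p_height_obtain:
  assumes a: "a \<in> carrier G" and p: "prime p" and fin: "p_height G a p = enat n"
  obtains b where "b \<in> carrier G" "b [^] int (p ^ n) = a" "b \<notin> multiples G p"
proof -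
  have "a \<in> multiples G (p ^ n)" "a \<notin> multiples G (p ^ Suc n)"
    using enat_le_p_height_iff[OF a, of n p] enat_le_p_height_iff[OF a, of "Suc n" p] fin by auto
  then obtain b where b: "b \<in> carrier G" "a = b [^] int (p ^ n)" unfolding mem_multiples_iff by blast
  have "b \<notin> multiples G p"
  proof
    assume "b \<in> multiples G p"
    then obtain c where c: "c \<in> carrier G" "b = c [^] int p" unfolding mem_multiples_iff by blast
    then have "a = c [^] int (p ^ Suc n)" using b by (simp add: int_pow_pow)
    with c \<open>a \<notin> multiples G (p ^ Suc n)\<close> show False unfolding mem_multiples_iff by blast
  qed
  then show ?thesis using that b by blast
qed

text \<open>
  At a prime where the height of \<open>h\<close> is finite, the root of \<open>h\<close> of height zero is added; otherwise
  the heights in the quotients of \<open>K\<close> are finite and the representatives for purity are added.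
  If \<open>h\<close>, or every \<open>x\<close> in its quotient, has height zero, nothing has to be added. Under the type hypothesis this is so
  at almost all primes, which lets one finite set serve all of them.
\<close>

lemma finite_set_excluding_prime:
  assumes H: "comm_group H" and K: "comm_group K" and tf: "torsion_free K"
    and max: "max_independent_in K X" and fin: "finite X" and p: "prime p" and h: "h \<in> carrier H"
  defines "\<gamma> \<equiv> \<lambda>x. p_height (K Mod pure_subgroup K (X - {x})) (pure_subgroup K (X - {x}) #>\<^bsub>K\<^esub> x) p"
  assumes bound: "p_height H h p \<noteq> \<infinity> \<or> (\<forall>x\<in>X. \<gamma> x \<noteq> \<infinity>)"
  shows "\<exists>F. finite F \<and> F \<subseteq> carrier (H \<times>\<times> K) \<and>
    (p_height H h p = 0 \<or> (\<forall>x\<in>X. \<gamma> x = 0) \<longrightarrow> F = {}) \<and>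
    (\<forall>E. subgroup E (H \<times>\<times> K) \<longrightarrow> (h, \<one>\<^bsub>K\<^esub>) \<in> E \<longrightarrow> (\<forall>x\<in>X. (\<one>\<^bsub>H\<^esub>, x) \<in> E) \<longrightarrow> F \<subseteq> E \<longrightarrow>
       excludes_prime H K h E p)"
proof -
  interpret H: comm_group H by fact
  interpret K: comm_group K by fact
  have result: ?thesis if "finite F" "F \<subseteq> carrier (H \<times>\<times> K)"
    "p_height H h p = 0 \<or> (\<forall>x\<in>X. \<gamma> x = 0) \<Longrightarrow> F = {}"
    "\<And>E. subgroup E (H \<times>\<times> K) \<Longrightarrow> (h, \<one>\<^bsub>K\<^esub>) \<in> E \<Longrightarrow> (\<And>x. x \<in> X \<Longrightarrow> (\<one>\<^bsub>H\<^esub>, x) \<in> E) \<Longrightarrow> F \<subseteq> E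
       \<Longrightarrow> excludes_prime H K h E p" for F
    using that by (intro exI[of _ F]) auto
  have purity: ?thesis if t: "\<And>x. x \<in> X \<Longrightarrow> \<gamma> x \<le> enat t"
    and z: "p_height H h p = 0 \<or> (\<forall>x\<in>X. \<gamma> x = 0) \<Longrightarrow> t = 0" for t
  proof -
    obtain S where S: "finite S" "S \<subseteq> carrier K" "t = 0 \<Longrightarrow> S = {}"
      "\<And>L k. subgroup L K \<Longrightarrow> X \<subseteq> L \<Longrightarrow> S \<subseteq> L \<Longrightarrow> k \<in> carrier K \<Longrightarrow> k [^]\<^bsub>K\<^esub> int p \<in> L \<Longrightarrow> k \<in> L"
      using K.finite_set_forcing_p_purity[OF tf max fin p t[unfolded \<gamma>_def]] by blast
    have X: "X \<subseteq> carrier K" using max by (simp add: independent_in_def max_independent_in_def)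
    show ?thesis
    proof (rule result[of "Pair \<one>\<^bsub>H\<^esub> ` S"])
      fix E assume E: "subgroup E (H \<times>\<times> K)" "\<And>x. x \<in> X \<Longrightarrow> (\<one>\<^bsub>H\<^esub>, x) \<in> E" "Pair \<one>\<^bsub>H\<^esub> ` S \<subseteq> E"
      define L where "L = {k \<in> carrier K. (\<one>\<^bsub>H\<^esub>, k) \<in> E}"
      have L: "subgroup L K" unfolding L_def using E(1)
        by (intro subgroup_second_slice) (auto intro: H.is_group K.is_group)
      have "X \<subseteq> L" "S \<subseteq> L" using X E S by (auto simp: L_def)
      from S(4)[OF L this] have "\<forall>k\<in>carrier K. (\<one>\<^bsub>H\<^esub>, k [^]\<^bsub>K\<^esub> int p) \<in> E \<longrightarrow> (\<one>\<^bsub>H\<^esub>, k) \<in> E"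
        by (auto simp: L_def)
      then show "excludes_prime H K h E p" unfolding excludes_prime_def ..
    qed (use S z in auto)
  qed
  consider "\<forall>x\<in>X. \<gamma> x = 0" | "p_height H h p = 0" | n where "p_height H h p = enat n" "p_height H h p \<noteq> 0" "\<not> (\<forall>x\<in>X. \<gamma> x = 0)"
    | "p_height H h p = \<infinity>" "\<forall>x\<in>X. \<gamma> x \<noteq> \<infinity>" "\<not> (\<forall>x\<in>X. \<gamma> x = 0)"
    using bound by (cases "p_height H h p") auto
  then show ?thesis
  proof cases
    case 1
    then show ?thesis by (intro purity[of 0]) auto
  next
    case 2
    then have "p_height H h p = enat 0" by (simp add: zero_enat_def)
    from H.finite_p_height_obtain[OF h p this]
    have "h \<notin> multiples H p" using h by auto
    then have "excludes_prime H K h E p" if "(h, \<one>\<^bsub>K\<^esub>) \<in> E" for E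
      unfolding excludes_prime_def using h that
      by (intro disjI1 bexI[of _ h] exI[of _ 0]) auto
    then show ?thesis by (intro result[of "{}"]) auto
  next
    case (3 n)
    obtain h1 where h1: "h1 \<in> carrier H" "h1 [^]\<^bsub>H\<^esub> int (p ^ n) = h" "h1 \<notin> multiples H p"
      using H.finite_p_height_obtain[OF h p 3(1)] .
    show ?thesis
      by (rule result[of "{(h1, \<one>\<^bsub>K\<^esub>)}"]) (use 3 h1 in \<open>auto simp: excludes_prime_def\<close>)
  next
    case 4
    define t where "t = Max (insert 0 ((\<lambda>x. the_enat (\<gamma> x)) ` X))"
    have "\<gamma> x \<le> enat t" if "x \<in> X" for x
    proof -
      have "the_enat (\<gamma> x) \<le> t" unfolding t_def using fin that by (intro Max_ge) auto
      then show ?thesis using 4(2) that by (cases "\<gamma> x") auto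
    qed
    then show ?thesis by (rule purity) (use 4 in auto)
  qed
qed

lemma DirProd_int_pow:
  assumes "group H" "group K" "a \<in> carrier H" "b \<in> carrier K"
  shows "(a, b) [^]\<^bsub>H \<times>\<times> K\<^esub> (n::int) = (a [^]\<^bsub>H\<^esub> n, b [^]\<^bsub>K\<^esub> n)"
proof -
  interpret G: group "H \<times>\<times> K" using assms by (simp add: DirProd_group)
  have car: "(a, b) \<in> carrier (H \<times>\<times> K)" using assms by simp
  have "fst \<in> hom (H \<times>\<times> K) H" "snd \<in> hom (H \<times>\<times> K) K"
    by (auto intro!: homI simp: mult_DirProd')
  from hom_int_pow[OF this(1) car G.is_group assms(1)] hom_int_pow[OF this(2) car G.is_group assms(2)]
  show ?thesis by (metis fst_conv snd_conv prod.collapse)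
qed

text \<open>
  Let \<open>w = d * c\<close> with \<open>c\<close> primitive. Since \<open>c\<close> has at least two positive coordinates,
  its \<open>H\<close>-component is \<open>p\<close> times that of some vector \<open>v\<close>. If \<open>h\<close> has a root
  \<open>h1\<close> in the stage that is not divisible by \<open>p\<close>, then \<open>h1\<close> is a multiple of the primitive
  element, which is divisible by \<open>p\<close> in \<open>H\<close>. If the stage meets \<open>K\<close> in a \<open>p\<close>-pure subgroup,
  then \<open>c - p * v\<close>, which maps into \<open>p K\<close>, is \<open>p\<close> times a vector, so \<open>p\<close> divides \<open>c\<close>.
  Both are impossible.
\<close>

lemma finite_stage_contradiction:
  assumes H: "comm_group H" and K: "comm_group K" and tf: "torsion_free K"
    and \<iota>: "\<iota> \<in> mon H rat_group"
    and e: "e \<in> hom (simplicial_group m) (H \<times>\<times> K)" and inj: "inj_on e (carrier (simplicial_group m))"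
    and m: "m \<ge> 2"
    and unit: "\<And>i. i < m \<Longrightarrow> \<iota> (fst (e (simplicial_unit m i))) > 0"
    and w: "w \<in> carrier (simplicial_group m)" "e w = (h, \<one>\<^bsub>K\<^esub>)" "\<And>i. i < m \<Longrightarrow> w i > 0"
    and ex: "\<And>p. prime p \<Longrightarrow> excludes_prime H K h (e ` carrier (simplicial_group m)) p"
  shows False
proof -
  interpret H: comm_group H by fact
  interpret K: comm_group K by fact
  interpret Z: group "simplicial_group m" by simp
  have G: "group (H \<times>\<times> K)" by (intro DirProd_group H.is_group K.is_group)
  define Zm where "Zm = simplicial_group m"
  define \<eta> where "\<eta> v = fst (e v)" for v
  define \<kappa> where "\<kappa> v = snd (e v)" for v
  have \<eta>: "\<eta> \<in> hom Zm H" and \<kappa>: "\<kappa> \<in> hom Zm K"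
    using e unfolding hom_pairwise \<eta>_def \<kappa>_def Zm_def comp_def by auto
  have e_eq: "e v = (\<eta> v, \<kappa> v)" for v by (simp add: \<eta>_def \<kappa>_def)
  have ZG: "group Zm" by (simp add: Zm_def)
  have \<eta>_pow: "\<eta> (v [^]\<^bsub>Zm\<^esub> n) = \<eta> v [^]\<^bsub>H\<^esub> n" and \<kappa>_pow: "\<kappa> (v [^]\<^bsub>Zm\<^esub> n) = \<kappa> v [^]\<^bsub>K\<^esub> n"
    if "v \<in> carrier Zm" for v and n :: int
    using hom_int_pow[OF \<eta> that ZG H.is_group] hom_int_pow[OF \<kappa> that ZG K.is_group] by auto
  have \<eta>_closed: "\<eta> v \<in> carrier H" and \<kappa>_closed: "\<kappa> v \<in> carrier K" if "v \<in> carrier Zm" for v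
    using hom_in_carrier[OF \<eta> that] hom_in_carrier[OF \<kappa> that] by auto
  have injZ: "v = v'" if "v \<in> carrier Zm" "v' \<in> carrier Zm" "\<eta> v = \<eta> v'" "\<kappa> v = \<kappa> v'" for v v'
    using inj that by (auto simp: e_eq inj_on_def Zm_def)
  have \<iota>_hom: "\<iota> \<in> hom H rat_group" and \<iota>_inj: "inj_on \<iota> (carrier H)" using \<iota> by (auto simp: mon_def)
  have pow_nth: "(v [^]\<^bsub>Zm\<^esub> n) i = n * v i" if "v \<in> carrier Zm" "i < m" for v i and n :: int
    using simplicial_int_pow_nth that by (simp add: Zm_def)
  have eqI: "v = v'" if "v \<in> carrier Zm" "v' \<in> carrier Zm" "\<And>i. i < m \<Longrightarrow> v i = v' i" for v v'
    using simplicial_eqI that by (simp add: Zm_def)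
  have pow_closed: "v [^]\<^bsub>Zm\<^esub> n \<in> carrier Zm" if "v \<in> carrier Zm" for v and n :: int
    using that Z.int_pow_closed by (simp add: Zm_def)
  have res: "restrict f {..<m} \<in> carrier Zm" for f :: "nat \<Rightarrow> int"
    by (simp add: Zm_def carrier_simplicial_group)
  have wZ: "w \<in> carrier Zm" and w\<eta>: "\<eta> w = h" and w\<kappa>: "\<kappa> w = \<one>\<^bsub>K\<^esub>"
    using w by (auto simp: Zm_def \<eta>_def \<kappa>_def)

  have m0: "m > 0" using m by simp
  obtain d c0 where d: "d > 0" and c0w: "\<forall>i<m. w i = d * c0 i \<and> c0 i > 0"
    and great: "\<forall>q. (\<forall>i<m. q dvd w i) \<longrightarrow> q dvd d"
    and prim: "\<forall>p. prime p \<longrightarrow> (\<exists>i<m. \<not> int p dvd c0 i)"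
    by (rule gcd_normalisation[of m w, OF m0 w(3)])
  have wc: "w i = d * c0 i" and c0: "c0 i > 0" if "i < m" for i using c0w that by auto
  define c where "c = restrict c0 {..<m}"
  have cZ: "c \<in> carrier Zm" using res by (simp add: c_def)
  have cd: "c [^]\<^bsub>Zm\<^esub> d = w"
    by (rule eqI[OF pow_closed[OF cZ] wZ]) (simp add: pow_nth[OF cZ], simp add: c_def wc)
  have "\<kappa> c [^]\<^bsub>K\<^esub> d = \<one>\<^bsub>K\<^esub>" using \<kappa>_pow[OF cZ, of d] cd w\<kappa> by simp
  then have c\<kappa>: "\<kappa> c = \<one>\<^bsub>K\<^esub>" using torsion_freeD[OF tf \<kappa>_closed[OF cZ], of d] d by simp

  define t where "t i = \<iota> (\<eta> (simplicial_unit m i))" for i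
  have \<theta>: "\<iota> (\<eta> v) = (\<Sum>i<m. of_int (v i) * t i)" if "v \<in> carrier Zm" for v
    using hom_simplicial_rat_eq_sum[of "\<iota> \<circ> \<eta>" m v] hom_compose[OF \<eta> \<iota>_hom] that
    by (simp add: Zm_def t_def)
  have tpos: "t i > 0" if "i < m" for i using unit[OF that] by (simp add: t_def \<eta>_def)
  obtain p v0 where p: "prime p"
    and pv: "of_nat p * (\<Sum>i<m. of_int (v0 i) * t i) = (\<Sum>i<m. of_int (c0 i) * t i)"
    by (rule positive_combination_divisible_by_prime[OF m tpos c0])
  define v where "v = restrict v0 {..<m}"
  have vZ: "v \<in> carrier Zm" using res by (simp add: v_def)
  have "\<iota> (\<eta> (v [^]\<^bsub>Zm\<^esub> int p)) = of_nat p * \<iota> (\<eta> v)"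
    using \<eta>_pow[OF vZ] hom_int_pow[OF \<iota>_hom \<eta>_closed[OF vZ] H.is_group group_rat_group]
    by (simp add: rat_group_int_pow)
  also have "\<dots> = \<iota> (\<eta> c)" using pv \<theta>[OF vZ] \<theta>[OF cZ] by (simp add: v_def c_def)
  finally have \<eta>c: "\<eta> v [^]\<^bsub>H\<^esub> int p = \<eta> c"
    using \<iota>_inj \<eta>_closed pow_closed vZ cZ \<eta>_pow by (metis inj_onD)

  from ex[OF p] consider
    h1 a where "h1 \<in> carrier H" "h1 [^]\<^bsub>H\<^esub> int (p ^ a) = h" "h1 \<notin> multiples H p"
      "(h1, \<one>\<^bsub>K\<^esub>) \<in> e ` carrier Zm"
    | "\<forall>k\<in>carrier K. (\<one>\<^bsub>H\<^esub>, k [^]\<^bsub>K\<^esub> int p) \<in> e ` carrier Zm \<longrightarrow> (\<one>\<^bsub>H\<^esub>, k) \<in> e ` carrier Zm"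
    unfolding excludes_prime_def Zm_def by blast
  then show False
  proof cases
    case (1 h1 a)
    then obtain u where u: "u \<in> carrier Zm" "\<eta> u = h1" "\<kappa> u = \<one>\<^bsub>K\<^esub>" by (auto simp: e_eq)
    have uw: "u [^]\<^bsub>Zm\<^esub> int (p ^ a) = w"
      using u 1 w\<eta> w\<kappa> wZ by (intro injZ pow_closed) (auto simp: \<eta>_pow \<kappa>_pow)
    then have w_u: "w i = int (p ^ a) * u i" if "i < m" for i
      using pow_nth[OF u(1) that] by metis
    then have "int (p ^ a) dvd d" using great by auto
    then obtain d' where d': "d = int (p ^ a) * d'" by (rule dvdE)
    have "u = c [^]\<^bsub>Zm\<^esub> d'"
    proof (rule eqI[OF u(1) pow_closed[OF cZ]])
      fix i assume i: "i < m"
      have "int (p ^ a) * u i = int (p ^ a) * (d' * c0 i)"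
        unfolding w_u[OF i, symmetric] wc[OF i] d' by (rule mult.assoc)
      then have "u i = d' * c0 i" using prime_gt_0_nat[OF p] by auto
      then show "u i = (c [^]\<^bsub>Zm\<^esub> d') i" using pow_nth[OF cZ i] i by (simp add: c_def)
    qed
    then have "h1 = (\<eta> v [^]\<^bsub>H\<^esub> int p) [^]\<^bsub>H\<^esub> d'" using u \<eta>_pow[OF cZ] \<eta>c by simp
    also have "\<dots> = (\<eta> v [^]\<^bsub>H\<^esub> d') [^]\<^bsub>H\<^esub> int p"
      using \<eta>_closed[OF vZ] by (simp add: H.int_pow_pow mult.commute)
    finally have "h1 \<in> multiples H p"
      unfolding H.mem_multiples_iff using \<eta>_closed[OF vZ] by blast
    then show False using 1 by blast
  next
    case 2
    \<comment> \<open>The \<open>H\<close>-components of \<open>c\<close> and \<open>p * v\<close> agree, so \<open>z\<close> maps into \<open>K\<close>.\<close>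
    define z where "z = restrict (\<lambda>i. c i - int p * v i) {..<m}"
    have zZ: "z \<in> carrier Zm" using res by (simp add: z_def)
    have czv: "c = z \<otimes>\<^bsub>Zm\<^esub> v [^]\<^bsub>Zm\<^esub> int p"
    proof (rule eqI[OF cZ])
      show "z \<otimes>\<^bsub>Zm\<^esub> v [^]\<^bsub>Zm\<^esub> int p \<in> carrier Zm"
        using Z.m_closed zZ pow_closed[OF vZ] by (simp add: Zm_def)
      show "c i = (z \<otimes>\<^bsub>Zm\<^esub> v [^]\<^bsub>Zm\<^esub> int p) i" if "i < m" for i
        using pow_nth[OF vZ that] that by (simp add: Zm_def simplicial_mult_nth z_def)
    qed
    define k where "k = inv\<^bsub>K\<^esub> (\<kappa> v)"
    have k: "k \<in> carrier K" using \<kappa>_closed[OF vZ] by (simp add: k_def)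
    have "\<eta> c = \<eta> z \<otimes>\<^bsub>H\<^esub> \<eta> c"
      using czv hom_mult[OF \<eta> zZ pow_closed[OF vZ]] \<eta>_pow[OF vZ] \<eta>c by metis
    then have z\<eta>: "\<eta> z = \<one>\<^bsub>H\<^esub>"
      using \<eta>_closed[OF zZ] \<eta>_closed[OF cZ] by simp
    have "\<one>\<^bsub>K\<^esub> = \<kappa> z \<otimes>\<^bsub>K\<^esub> \<kappa> v [^]\<^bsub>K\<^esub> int p"
      using czv hom_mult[OF \<kappa> zZ pow_closed[OF vZ]] \<kappa>_pow[OF vZ] c\<kappa> by metis
    then have "\<kappa> z = inv\<^bsub>K\<^esub> (\<kappa> v [^]\<^bsub>K\<^esub> int p)"
      using \<kappa>_closed[OF zZ] \<kappa>_closed[OF vZ] by (metis K.inv_equality K.int_pow_closed)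
    then have z\<kappa>: "\<kappa> z = k [^]\<^bsub>K\<^esub> int p" using \<kappa>_closed[OF vZ] by (simp add: k_def K.int_pow_inv)
    have "(\<one>\<^bsub>H\<^esub>, k [^]\<^bsub>K\<^esub> int p) \<in> e ` carrier Zm"
      using zZ z\<eta> z\<kappa> e_eq by (metis imageI)
    then obtain y where y: "y \<in> carrier Zm" "\<eta> y = \<one>\<^bsub>H\<^esub>" "\<kappa> y = k" using 2 k by (auto simp: e_eq)
    have yz: "y [^]\<^bsub>Zm\<^esub> int p = z"
      using y zZ z\<eta> z\<kappa> by (intro injZ pow_closed) (auto simp: \<eta>_pow \<kappa>_pow)
    obtain i where i: "i < m" "\<not> int p dvd c0 i" using prim p by blast
    have "c0 i - int p * v i = int p * y i"
      using pow_nth[OF y(1) i(1), of "int p"] yz i by (simp add: z_def c_def)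
    then have "c0 i = int p * (y i + v i)" by (simp add: algebra_simps)
    with i show False by simp
  qed
qed

section \<open>Strict positivity at a finite stage\<close>

lemma rat_commensurable:
  assumes "x \<noteq> 0" "y \<noteq> (0::rat)"
  shows "\<exists>(m::int) (n::int). m \<noteq> 0 \<and> n \<noteq> 0 \<and> of_int m * y = of_int n * x"
proof -
  obtain a b where ab: "y / x = of_int a / of_int b" "b > 0"
    by (metis quotient_of_div quotient_of_denom_pos surj_pair)
  then have "of_int b * y = of_int a * x" "a \<noteq> 0" using assms by (auto simp: field_simps)
  then show ?thesis using ab(2) by (intro exI[of _ b] exI[of _ a]) auto
qed

lemma embedded_commensurable:
  assumes H: "group H" and \<iota>: "\<iota> \<in> mon H rat_group"
    and a: "a \<in> carrier H" "a \<noteq> \<one>\<^bsub>H\<^esub>" and b: "b \<in> carrier H" "b \<noteq> \<one>\<^bsub>H\<^esub>"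
  shows "\<exists>(m::int) (n::int). m \<noteq> 0 \<and> n \<noteq> 0 \<and> b [^]\<^bsub>H\<^esub> m = a [^]\<^bsub>H\<^esub> n"
proof -
  interpret H: group H by fact
  have hom: "\<iota> \<in> hom H rat_group" and inj: "inj_on \<iota> (carrier H)" using \<iota> by (auto simp: mon_def)
  have one: "\<iota> \<one>\<^bsub>H\<^esub> = 0" using hom_one[OF hom H group_rat_group] by simp
  have "\<iota> a \<noteq> 0" "\<iota> b \<noteq> 0" using a b one inj by (metis H.one_closed inj_onD)+
  then obtain m n :: int where mn: "m \<noteq> 0" "n \<noteq> 0" "of_int m * \<iota> b = of_int n * \<iota> a"
    using rat_commensurable by metis
  then have "\<iota> (b [^]\<^bsub>H\<^esub> m) = \<iota> (a [^]\<^bsub>H\<^esub> n)"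
    using hom_int_pow[OF hom a(1) H group_rat_group] hom_int_pow[OF hom b(1) H group_rat_group]
    by (simp add: rat_group_int_pow)
  then have "b [^]\<^bsub>H\<^esub> m = a [^]\<^bsub>H\<^esub> n"
    using inj_onD[OF inj] a b by blast
  with mn show ?thesis by blast
qed

text \<open>
  Since \<open>(h, x)\<close> and \<open>(h, - x)\<close> are positive with sum \<open>2 (h, 0)\<close>, a coordinate that vanishes on
  \<open>(h, 0)\<close> vanishes on both, and hence on \<open>(0, x)\<close>. These elements span the group up to torsion,
  so such a coordinate would vanish on its own basis vector. Two coordinates are
  needed because an element \<open>(0, x) \<noteq> 0\<close> of the stage has \<open>H\<close>-component zero although all basis
  vectors have positive \<open>H\<close>-component.
\<close>

lemma finite_stage_positivity:
  assumes H: "comm_group H" and K: "comm_group K" and tf: "torsion_free K"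
    and \<iota>: "\<iota> \<in> mon H rat_group"
    and max: "max_independent_in K X" and fin: "finite X" and ne: "X \<noteq> {}"
    and h: "h \<in> carrier H" "h \<noteq> \<one>\<^bsub>H\<^esub>"
    and e: "e \<in> hom (simplicial_group m) (H \<times>\<times> K)" and inj: "inj_on e (carrier (simplicial_group m))"
    and pos: "e ` simplicial_cone m \<subseteq> strict_first_cone H K \<iota>"
    and w: "w \<in> simplicial_cone m" "e w = (h, \<one>\<^bsub>K\<^esub>)"
    and ups: "\<And>x. x \<in> X \<Longrightarrow> (h, x) \<in> e ` simplicial_cone m"
    and downs: "\<And>x. x \<in> X \<Longrightarrow> (h, inv\<^bsub>K\<^esub> x) \<in> e ` simplicial_cone m"
  shows "\<And>i. i < m \<Longrightarrow> w i > 0" and "m \<ge> 2"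
    and "\<And>i. i < m \<Longrightarrow> \<iota> (fst (e (simplicial_unit m i))) > 0"
    and "\<And>x. x \<in> X \<Longrightarrow> (\<one>\<^bsub>H\<^esub>, x) \<in> e ` carrier (simplicial_group m)"
proof -
  interpret H: comm_group H by fact
  interpret K: comm_group K by fact
  define Zm where "Zm = simplicial_group m"
  interpret Z: group Zm by (simp add: Zm_def)
  interpret G: group "H \<times>\<times> K" by (intro DirProd_group H.is_group K.is_group)
  interpret e: group_hom Zm "H \<times>\<times> K" e
    by unfold_locales (use e in \<open>simp add: Zm_def\<close>)
  have X: "X \<subseteq> carrier K" and ind: "independent_in K X"
    using max by (auto simp: max_independent_in_def independent_in_def)
  have coneZ: "simplicial_cone m \<subseteq> carrier Zm" by (auto simp: simplicial_cone_def Zm_def)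
  have wZ: "w \<in> carrier Zm" using w coneZ by blast
  have inj': "v = v'" if "v \<in> carrier Zm" "v' \<in> carrier Zm" "e v = e v'" for v v'
    using inj_onD[OF inj] that by (simp add: Zm_def)
  have mult_nth: "(v \<otimes>\<^bsub>Zm\<^esub> v') i = v i + v' i" if "i < m" for v v' i
    using simplicial_mult_nth[OF that] by (simp add: Zm_def)
  have nonneg: "v i \<ge> 0" if "v \<in> simplicial_cone m" "i < m" for v i
    using that by (simp add: simplicial_cone_def)
  have uZ: "simplicial_unit m i \<in> carrier Zm" for i by (simp add: Zm_def)
  have slice: "(\<one>\<^bsub>H\<^esub>, x) \<in> E" if "subgroup E (H \<times>\<times> K)" "(h, \<one>\<^bsub>K\<^esub>) \<in> E" "(h, x) \<in> E" "x \<in> X" for E x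
  proof -
    have "inv\<^bsub>H \<times>\<times> K\<^esub> (h, \<one>\<^bsub>K\<^esub>) \<otimes>\<^bsub>H \<times>\<times> K\<^esub> (h, x) \<in> E"
      using that by (intro subgroup.m_closed[OF that(1)] subgroup.m_inv_closed[OF that(1)])
    then show ?thesis using that(4) X h by (simp add: H.is_group K.is_group subset_iff)
  qed
  have eZ: "subgroup (e ` carrier Zm) (H \<times>\<times> K)" by (rule e.img_is_subgroup)
  have mem: "(\<one>\<^bsub>H\<^esub>, x) \<in> e ` carrier Zm" if "x \<in> X" for x
  proof (rule slice[OF eZ _ _ that])
    show "(h, \<one>\<^bsub>K\<^esub>) \<in> e ` carrier Zm" using w wZ by (metis imageI)
    show "(h, x) \<in> e ` carrier Zm" using ups[OF that] coneZ by blast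
  qed
  then show "\<And>x. x \<in> X \<Longrightarrow> (\<one>\<^bsub>H\<^esub>, x) \<in> e ` carrier (simplicial_group m)" by (simp add: Zm_def)
  show unit: "\<iota> (fst (e (simplicial_unit m i))) > 0" if i: "i < m" for i
  proof -
    have "simplicial_unit m i \<in> simplicial_cone m"
      using uZ by (simp add: simplicial_cone_def simplicial_unit_nth Zm_def)
    then have "e (simplicial_unit m i) \<in> strict_first_cone H K \<iota>" using pos by blast
    moreover have "e (simplicial_unit m i) \<noteq> \<one>\<^bsub>H \<times>\<times> K\<^esub>"
    proof
      assume "e (simplicial_unit m i) = \<one>\<^bsub>H \<times>\<times> K\<^esub>"
      then have "simplicial_unit m i = \<one>\<^bsub>Zm\<^esub>"
        using inj'[OF uZ Z.one_closed] e.hom_one by simp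
      then have "simplicial_unit m i i = 0" using simplicial_one_nth[OF i] by (simp add: Zm_def)
      then show False using i by (simp add: simplicial_unit_nth)
    qed
    ultimately show ?thesis by (auto simp: strict_first_cone_def)
  qed
  show "w i > 0" if i: "i < m" for i
  proof (rule ccontr)
    assume "\<not> w i > 0"
    then have wi: "w i = 0" using nonneg[OF w(1) i] by simp
    \<comment> \<open>The face on which the supposedly vanishing coordinate is zero.\<close>
    define F where "F = {v \<in> carrier Zm. v i = 0}"
    have "subgroup F Zm"
    proof (rule Z.subgroupI)
      have "\<one>\<^bsub>Zm\<^esub> \<in> F" using Z.one_closed simplicial_one_nth[OF i] by (simp add: F_def Zm_def)
      then show "F \<noteq> {}" by blast
      fix a assume a: "a \<in> F"
      have "(a \<otimes>\<^bsub>Zm\<^esub> inv\<^bsub>Zm\<^esub> a) i = 0"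
        using a simplicial_one_nth[OF i] by (simp add: F_def Zm_def[symmetric])
      then show "inv\<^bsub>Zm\<^esub> a \<in> F" using a mult_nth[OF i] by (simp add: F_def)
      fix b assume "b \<in> F"
      then show "a \<otimes>\<^bsub>Zm\<^esub> b \<in> F" using a mult_nth[OF i] by (simp add: F_def)
    qed (auto simp: F_def)
    then have E: "subgroup (e ` F) (H \<times>\<times> K)" by (rule e.subgroup_img_is_subgroup)
    have hE: "(h, \<one>\<^bsub>K\<^esub>) \<in> e ` F" using w wZ wi by (auto simp: F_def image_iff)
    have xE: "(\<one>\<^bsub>H\<^esub>, x) \<in> e ` F" if x: "x \<in> X" for x
    proof (rule slice[OF E hE _ x])
      obtain a b where a: "a \<in> simplicial_cone m" "e a = (h, x)"
        and b: "b \<in> simplicial_cone m" "e b = (h, inv\<^bsub>K\<^esub> x)"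
        using ups[OF x] downs[OF x] by (metis imageE)
      have aZ: "a \<in> carrier Zm" and bZ: "b \<in> carrier Zm" using a b coneZ by auto
      have "e (a \<otimes>\<^bsub>Zm\<^esub> b) = e (w \<otimes>\<^bsub>Zm\<^esub> w)"
        using e.hom_mult[OF aZ bZ] e.hom_mult[OF wZ wZ] a b w x X by (auto simp: subset_iff)
      then have "a \<otimes>\<^bsub>Zm\<^esub> b = w \<otimes>\<^bsub>Zm\<^esub> w" using inj' aZ bZ wZ by blast
      then have "a i + b i = 0" using mult_nth[OF i] wi by (metis add_0)
      then have "a i = 0" using nonneg[OF a(1) i] nonneg[OF b(1) i] by simp
      then show "(h, x) \<in> e ` F" using a aZ by (auto simp: F_def image_iff)
    qed
    define L where "L = {k \<in> carrier K. (\<one>\<^bsub>H\<^esub>, k) \<in> e ` F}"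
    have L: "subgroup L K" unfolding L_def
      by (rule subgroup_second_slice[OF H.is_group K.is_group E])
    have "X \<subseteq> L" using xE X by (auto simp: L_def)
    then have gL: "generate K X \<subseteq> L" using K.generate_subgroup_incl L by blast
    obtain \<eta> \<kappa> where \<eta>\<kappa>: "e (simplicial_unit m i) = (\<eta>, \<kappa>)" by fastforce
    then have car: "\<eta> \<in> carrier H" "\<kappa> \<in> carrier K" using e.hom_closed[OF uZ, of i] by auto
    have "\<eta> \<noteq> \<one>\<^bsub>H\<^esub>"
    proof
      assume "\<eta> = \<one>\<^bsub>H\<^esub>"
      moreover have "\<iota> \<one>\<^bsub>H\<^esub> = 0"
        using \<iota> hom_one[of \<iota> H rat_group] H.is_group group_rat_group by (simp add: mon_def)
      ultimately show False using unit[OF i] \<eta>\<kappa> by simp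
    qed
    then obtain n1 l :: int where n1: "n1 \<noteq> 0" "\<eta> [^]\<^bsub>H\<^esub> n1 = h [^]\<^bsub>H\<^esub> l"
      using embedded_commensurable[OF H.is_group \<iota> h car(1)] by blast
    obtain n2 :: int and c where n2: "n2 \<noteq> 0" "\<kappa> [^]\<^bsub>K\<^esub> n2 = int_comb K X c"
      using K.max_independent_pow_eq_int_comb[OF max fin car(2)] by blast
    then have "\<kappa> [^]\<^bsub>K\<^esub> n2 \<in> L" using gL K.generate_eq_range_int_comb[OF fin X] by auto
    then have k2: "(\<one>\<^bsub>H\<^esub>, \<kappa> [^]\<^bsub>K\<^esub> n2) \<in> e ` F" by (simp add: L_def)
    have "(h, \<one>\<^bsub>K\<^esub>) [^]\<^bsub>H \<times>\<times> K\<^esub> (l * n2) \<otimes>\<^bsub>H \<times>\<times> K\<^esub> (\<one>\<^bsub>H\<^esub>, \<kappa> [^]\<^bsub>K\<^esub> n2) [^]\<^bsub>H \<times>\<times> K\<^esub> n1 \<in> e ` F"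
      by (intro subgroup.m_closed[OF E] G.subgroup_int_pow_closed[OF E] hE k2)
    also have "(h, \<one>\<^bsub>K\<^esub>) [^]\<^bsub>H \<times>\<times> K\<^esub> (l * n2) = (\<eta> [^]\<^bsub>H\<^esub> (n1 * n2), \<one>\<^bsub>K\<^esub>)"
      using h car n1 by (simp add: DirProd_int_pow H.is_group K.is_group flip: H.int_pow_pow)
    also have "(\<one>\<^bsub>H\<^esub>, \<kappa> [^]\<^bsub>K\<^esub> n2) [^]\<^bsub>H \<times>\<times> K\<^esub> n1 = (\<one>\<^bsub>H\<^esub>, \<kappa> [^]\<^bsub>K\<^esub> (n1 * n2))"
      using car by (simp add: DirProd_int_pow H.is_group K.is_group K.int_pow_pow mult.commute)
    also have "(\<eta> [^]\<^bsub>H\<^esub> (n1 * n2), \<one>\<^bsub>K\<^esub>) \<otimes>\<^bsub>H \<times>\<times> K\<^esub> (\<one>\<^bsub>H\<^esub>, \<kappa> [^]\<^bsub>K\<^esub> (n1 * n2))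
        = (\<eta>, \<kappa>) [^]\<^bsub>H \<times>\<times> K\<^esub> (n1 * n2)"
      using car by (simp add: DirProd_int_pow H.is_group K.is_group)
    also have "\<dots> = e (simplicial_unit m i [^]\<^bsub>Zm\<^esub> (n1 * n2))"
      using e.hom_int_pow[OF uZ] \<eta>\<kappa> by metis
    finally obtain f where f: "f \<in> F" "e (simplicial_unit m i [^]\<^bsub>Zm\<^esub> (n1 * n2)) = e f" by blast
    then have "simplicial_unit m i [^]\<^bsub>Zm\<^esub> (n1 * n2) = f"
      using inj' uZ Z.int_pow_closed by (simp add: F_def)
    then have "(simplicial_unit m i [^]\<^bsub>Zm\<^esub> (n1 * n2)) i = 0" using f by (simp add: F_def)
    then have "n1 * n2 = 0"
      using simplicial_int_pow_nth[OF simplicial_unit_closed i, of i "n1 * n2"] i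
      by (simp add: Zm_def simplicial_unit_nth)
    then show False using n1 n2 by simp
  qed
  show "m \<ge> 2"
  proof (rule ccontr)
    assume "\<not> m \<ge> 2"
    then have m: "m = 0 \<or> m = 1" by linarith
    obtain x where x: "x \<in> X" using ne by blast
    obtain y where y: "y \<in> carrier Zm" "e y = (\<one>\<^bsub>H\<^esub>, x)" using mem[OF x] by (metis imageE)
    have "fst \<in> hom (H \<times>\<times> K) H" by (auto intro!: homI simp: mult_DirProd')
    moreover have \<iota>_hom: "\<iota> \<in> hom H rat_group" using \<iota> by (simp add: mon_def)
    ultimately have "\<iota> \<circ> (fst \<circ> e) \<in> hom (simplicial_group m) rat_group"
      using e by (intro hom_compose)
    from hom_simplicial_rat_eq_sum[OF this, of y]
    have "(\<Sum>i<m. of_int (y i) * \<iota> (fst (e (simplicial_unit m i)))) = 0"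
      using y hom_one[OF \<iota>_hom H.is_group group_rat_group] by (simp add: Zm_def)
    then have "y i = 0" if "i < m" for i using m unit[OF that] that by auto
    then have "y = \<one>\<^bsub>Zm\<^esub>"
      using y(1) Z.one_closed unfolding Zm_def by (intro simplicial_eqI) (auto simp: simplicial_one_nth)
    then have "x = \<one>\<^bsub>K\<^esub>" using y e.hom_one by simp
    then have "int_comb K {x} (\<lambda>_. 1) = \<one>\<^bsub>K\<^esub>" by (simp add: int_comb_def)
    then have "(1::int) = 0"
      using K.independent_int_comb_eq_one[OF ind, of "{x}" "\<lambda>_. 1" x] x by simp
    then show False by simp
  qed
qed

section \<open>Failure of ultrasimpliciality\<close>

lemma nontrivial_of_rank_one:
  assumes "comm_group H" "has_rank H 1"
  shows "\<exists>h\<in>carrier H. h \<noteq> \<one>\<^bsub>H\<^esub>"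
proof -
  interpret comm_group H by fact
  obtain X where X: "max_independent_in H X" "card X = 1" using assms by (auto simp: has_rank_def)
  then obtain x where x: "X = {x}" by (auto simp: card_1_singleton_iff)
  have ind: "independent_in H {x}" using X x by (simp add: max_independent_in_def)
  have "x \<noteq> \<one>\<^bsub>H\<^esub>"
  proof
    assume "x = \<one>\<^bsub>H\<^esub>"
    then have "int_comb H {x} (\<lambda>_. 1) = \<one>\<^bsub>H\<^esub>" by (simp add: int_comb_def)
    then have "(1::int) = 0" using independent_int_comb_eq_one[OF ind, of "{x}" "\<lambda>_. 1" x] by simp
    then show False by simp
  qed
  then show ?thesis using ind by (auto simp: independent_in_def)
qed

theorem proposition4p6:
  fixes H :: "('h, 'c) monoid_scheme" and K :: "('k, 'd) monoid_scheme" and \<iota> :: "'h \<Rightarrow> rat"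
  assumes "comm_group H" and "torsion_free H" and "has_rank H 1"
    and "\<iota> \<in> mon H rat_group"
    and "comm_group K" and "torsion_free K" and "finite_rank K" and "carrier K \<noteq> {\<one>\<^bsub>K\<^esub>}"
    and "inf (outer_type K) (group_type H) = group_type integer_group"
  shows "\<not> ultrasimplicial (H \<times>\<times> K) (strict_first_cone H K \<iota>)"
proof
  assume us: "ultrasimplicial (H \<times>\<times> K) (strict_first_cone H K \<iota>)"
  note \<iota> = assms(4)
  interpret H: comm_group H by fact
  interpret K: comm_group K by fact
  have \<iota>_hom: "\<iota> \<in> hom H rat_group" and \<iota>_inj: "inj_on \<iota> (carrier H)" using \<iota> by (auto simp: mon_def)
  have \<iota>_one: "\<iota> \<one>\<^bsub>H\<^esub> = 0" using hom_one[OF \<iota>_hom H.is_group group_rat_group] by simp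
  obtain h0 where h0: "h0 \<in> carrier H" "h0 \<noteq> \<one>\<^bsub>H\<^esub>"
    using nontrivial_of_rank_one[OF assms(1,3)] by blast
  have h0_ne: "\<iota> h0 \<noteq> 0" using h0 \<iota>_one \<iota>_inj by (metis H.one_closed inj_onD)
  obtain h where h: "h \<in> carrier H" "\<iota> h > 0"
  proof (cases "\<iota> h0 > 0")
    case False
    have "\<iota> (h0 [^]\<^bsub>H\<^esub> (- 1 :: int)) = - \<iota> h0"
      using hom_int_pow[OF \<iota>_hom h0(1) H.is_group group_rat_group] by (simp add: rat_group_int_pow)
    then show ?thesis using that[of "h0 [^]\<^bsub>H\<^esub> (- 1 :: int)"] h0 h0_ne False by simp
  qed (use h0 that in blast)
  have h1: "h \<noteq> \<one>\<^bsub>H\<^esub>" using h \<iota>_one by auto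
  have typeH: "group_type H = abs_htype (p_height H h)"
    using H.group_type_eq_type_of[OF assms(2) h(1) h1]
      embedded_commensurable[OF H.is_group \<iota> h(1) h1] by (simp add: type_of_def)
  obtain X where fin: "finite X" and max: "max_independent_in K X" and ne: "X \<noteq> {}"
    and typeK: "outer_type K = abs_htype (\<lambda>p. Max ((\<lambda>x.
       p_height (K Mod pure_subgroup K (X - {x})) (pure_subgroup K (X - {x}) #>\<^bsub>K\<^esub> x) p) ` X))"
    by (rule K.outer_type_eq_sup_heights[OF assms(6-8)])
  have X: "X \<subseteq> carrier K" using max by (simp add: max_independent_in_def independent_in_def)
  define \<gamma> where "\<gamma> p x = p_height (K Mod pure_subgroup K (X - {x})) (pure_subgroup K (X - {x}) #>\<^bsub>K\<^esub> x) p" for p x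
  define bad where "bad = {p. prime p \<and> min (Max (\<gamma> p ` X)) (p_height H h p) \<noteq> 0}"
  have teq: "inf (abs_htype (\<lambda>p. Max (\<gamma> p ` X))) (abs_htype (p_height H h)) = group_type integer_group"
    using assms(9) typeH typeK unfolding \<gamma>_def by simp
  have bad_fin: "finite bad" unfolding bad_def by (rule type_hypothesis_heights(1)[OF teq])
  have le_Max: "\<gamma> p x \<le> Max (\<gamma> p ` X)" if "x \<in> X" for p x using fin that by simp
  define \<Phi> where "\<Phi> p F \<longleftrightarrow> finite F \<and> F \<subseteq> carrier (H \<times>\<times> K) \<and> (p \<notin> bad \<longrightarrow> F = {}) \<and>
      (\<forall>E. subgroup E (H \<times>\<times> K) \<longrightarrow> (h, \<one>\<^bsub>K\<^esub>) \<in> E \<longrightarrow> (\<forall>x\<in>X. (\<one>\<^bsub>H\<^esub>, x) \<in> E) \<longrightarrow> F \<subseteq> E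
       \<longrightarrow> excludes_prime H K h E p)" for p F
  have "\<exists>F. \<Phi> p F" if p: "prime p" for p
  proof -
    have bound: "p_height H h p \<noteq> \<infinity> \<or> (\<forall>x\<in>X. \<gamma> p x \<noteq> \<infinity>)"
    proof (rule disjCI, rule notI)
      assume "\<not> (\<forall>x\<in>X. \<gamma> p x \<noteq> \<infinity>)"
      then obtain x where "x \<in> X" "\<gamma> p x = \<infinity>" by blast
      then have "Max (\<gamma> p ` X) = \<infinity>" using le_Max[of x p] by simp
      assume "p_height H h p = \<infinity>"
      then show False
        using type_hypothesis_heights(2)[OF teq p] \<open>Max (\<gamma> p ` X) = \<infinity>\<close> by simp
    qed
    have good: "p_height H h p = 0 \<or> (\<forall>x\<in>X. \<gamma> p x = 0)" if "p \<notin> bad"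
      using that p le_Max[of _ p] by (auto simp: bad_def min_def split: if_splits)
    show ?thesis
      using finite_set_excluding_prime[OF assms(1,5,6) max fin p h(1), folded \<gamma>_def, OF bound] good
      unfolding \<Phi>_def
      by (elim exE conjE) (intro exI conjI; blast)
  qed
  then have "\<forall>p\<in>{p. prime p}. \<exists>F. \<Phi> p F" by auto
  from bchoice[OF this] obtain F where "\<forall>p\<in>{p. prime p}. \<Phi> p (F p)" by (rule exE)
  then have \<Phi>: "\<Phi> p (F p)" if "prime p" for p using that by simp
  have F: "finite (F p)" "F p \<subseteq> carrier (H \<times>\<times> K)" "p \<notin> bad \<Longrightarrow> F p = {}"
    "subgroup E (H \<times>\<times> K) \<Longrightarrow> (h, \<one>\<^bsub>K\<^esub>) \<in> E \<Longrightarrow> \<forall>x\<in>X. (\<one>\<^bsub>H\<^esub>, x) \<in> E \<Longrightarrow> F p \<subseteq> E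
       \<Longrightarrow> excludes_prime H K h E p" if "prime p" for p E
    using \<Phi>[OF that] unfolding \<Phi>_def by auto
  \<comment> \<open>The elements \<open>(h, x)\<close> and \<open>(h, - x)\<close> make the coordinates of \<open>(h, 0)\<close> strictly positive; the sets \<open>F p\<close> exclude the finitely many bad primes.\<close>
  define S where "S = {(h, \<one>\<^bsub>K\<^esub>)} \<union> Pair h ` X \<union> (\<lambda>x. (h, inv\<^bsub>K\<^esub> x)) ` X \<union> (\<Union>p\<in>bad. F p)"
  have badp: "prime p" if "p \<in> bad" for p using that unfolding bad_def by blast
  have "finite S" unfolding S_def using fin bad_fin F(1) badp by auto
  moreover have "S \<subseteq> carrier (H \<times>\<times> K)"
    unfolding S_def using h X F(2)[OF badp] by (intro Un_least UN_least) auto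
  ultimately obtain m e where e: "e \<in> hom (simplicial_group m) (H \<times>\<times> K)"
    and inj: "inj_on e (carrier (simplicial_group m))"
    and pos: "e ` simplicial_cone m \<subseteq> strict_first_cone H K \<iota>"
    and Sim: "S \<subseteq> e ` carrier (simplicial_group m)"
    and Spos: "S \<inter> strict_first_cone H K \<iota> \<subseteq> e ` simplicial_cone m"
    by (rule ultrasimplicial_finite_stage[OF us])
  define E where "E = e ` carrier (simplicial_group m)"
  have cone: "(h, k) \<in> e ` simplicial_cone m" if "(h, k) \<in> S" "k \<in> carrier K" for k
    using that Spos h by (auto simp: strict_first_cone_def)
  obtain w where w: "w \<in> simplicial_cone m" "e w = (h, \<one>\<^bsub>K\<^esub>)"
    using cone[of "\<one>\<^bsub>K\<^esub>"] by (force simp: S_def)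
  have ups: "(h, x) \<in> e ` simplicial_cone m" and downs: "(h, inv\<^bsub>K\<^esub> x) \<in> e ` simplicial_cone m"
    if "x \<in> X" for x
    using that X by (auto intro!: cone simp: S_def)
  note stage = finite_stage_positivity[OF assms(1,5,6) \<iota> max fin ne h(1) h1 e inj pos w ups downs]
  have wZ: "w \<in> carrier (simplicial_group m)" using w by (simp add: simplicial_cone_def)
  have Esub: "subgroup E (H \<times>\<times> K)"
    unfolding E_def by (intro group_hom.img_is_subgroup group_hom.intro group_hom_axioms.intro
        group_simplicial_group DirProd_group H.is_group K.is_group e)
  have excl: "excludes_prime H K h E p" if p: "prime p" for p
  proof (rule F(4)[OF p Esub])
    show "(h, \<one>\<^bsub>K\<^esub>) \<in> E" unfolding E_def using w wZ by (metis imageI)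
    show "\<forall>x\<in>X. (\<one>\<^bsub>H\<^esub>, x) \<in> E" unfolding E_def using stage(4) by blast
    show "F p \<subseteq> E"
    proof (cases "p \<in> bad")
      case True
      then show ?thesis using Sim by (auto simp: S_def E_def)
    qed (use F(3)[OF p] in simp)
  qed
  show False
    by (rule finite_stage_contradiction[OF assms(1,5,6) \<iota> e inj stage(2) stage(3) wZ w(2) stage(1)])
      (use excl in \<open>auto simp: E_def\<close>)
qed

end
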